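(* Let $n\ge3$, $d\ge2$ and $V\in\mathcal{B}_{n/2}\cap\mathcal{ND}$. There is a constant $C$, depending only on $d,n,C_V$, such that for every open cube $Q\subset\mathbb{R}^n$ and every $C^1$ function $\vec u:Q\to\mathbb{R}^d$, $$\int_Q\int_Q\left|V(Q)^{-1/2}V^{1/2}(y)\big(\vec u(x)-\vec u(y)\big)\right|^2dx\,dy\le C\,|Q|^{2/n}\int_Q|D\vec u(x)|^2\,dx.$$
   Context: A matrix weight is a $d\times d$ real symmetric positive semidefinite measurable matrix function on $\mathbb{R}^n$. For $p>1$, $V\in\mathcal{B}_p$ if $V$ is a matrix weight, $V\in L^p_{loc}(\mathbb{R}^n)$ and there is $C_V$ with $\big(\frac1{|Q|}\int_Q\langle V\vec e,\vec e\rangle^p\big)^{1/p}\le C_V\big\langle\big(\frac1{|Q|}\int_QV\big)\vec e,\vec e\big\rangle$ for all (axis-parallel) cubes $Q$ and $\vec e\in\mathbb{R}^d$. $V\in\mathcal{ND}$ if $V(E):=\int_EV$ is positive definite for every measurable $E$ with $|E|>0$. $V(Q)=\int_QV(y)\,dy$. *)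

theory Defs
  imports "HOL-Analysis.Analysis"
begin

definition psd_matrix :: "real^'d^'d \<Rightarrow> bool" where
  "psd_matrix A \<longleftrightarrow> transpose A = A \<and> (\<forall>e. 0 \<le> (A *v e) \<bullet> e)"

definition pd_matrix :: "real^'d^'d \<Rightarrow> bool" where
  "pd_matrix A \<longleftrightarrow> transpose A = A \<and> (\<forall>e. e \<noteq> 0 \<longrightarrow> 0 < (A *v e) \<bullet> e)"

text \<open>Only meaningful for positive semidefinite arguments, where the positive semidefinite
  square root exists and is unique.\<close>

definition psd_sqrt :: "real^'d^'d \<Rightarrow> real^'d^'d" where
  "psd_sqrt A = (THE B. psd_matrix B \<and> B ** B = A)"

definition matrix_weight :: "(real^'n \<Rightarrow> real^'d^'d) \<Rightarrow> bool" where
  "matrix_weight V \<longleftrightarrow> V \<in> borel_measurable lebesgue \<and> (\<forall>x. psd_matrix (V x))"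

text \<open>Axis-parallel cubes with corner \<open>a\<close> and side length \<open>r\<close>. Taking them open does not affect
  the averages in the reverse Hoelder condition, since the boundary of a cube is a null set.\<close>

definition open_cube :: "(real^'n) set \<Rightarrow> bool" where
  "open_cube Q \<longleftrightarrow> (\<exists>a r. 0 < r \<and> Q = box a (\<chi> i. a $ i + r))"

definition weight_mass :: "(real^'n \<Rightarrow> real^'d^'d) \<Rightarrow> (real^'n) set \<Rightarrow> real^'d^'d" where
  "weight_mass V E = (LINT y:E|lebesgue. V y)"

definition locally_Lp :: "real \<Rightarrow> (real^'n \<Rightarrow> real^'d^'d) \<Rightarrow> bool" where
  "locally_Lp p V \<longleftrightarrow> V \<in> borel_measurable lebesgue \<and>
     (\<forall>K. compact K \<longrightarrow> set_integrable lebesgue K (\<lambda>x. norm (V x) powr p))"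

text \<open>The number \<open>C\<close> is an admissible constant \<open>C\<^sub>V\<close> in the \<open>B\<^sub>p\<close> condition for \<open>V\<close>.\<close>

definition Bp_constant :: "real \<Rightarrow> (real^'n \<Rightarrow> real^'d^'d) \<Rightarrow> real \<Rightarrow> bool" where
  "Bp_constant p V C \<longleftrightarrow> (\<forall>Q e. open_cube Q \<longrightarrow>
     ((1 / measure lebesgue Q) * (LINT x:Q|lebesgue. ((V x *v e) \<bullet> e) powr p)) powr (1 / p)
       \<le> C * ((((1 / measure lebesgue Q) *\<^sub>R weight_mass V Q) *v e) \<bullet> e))"

definition Bp_class :: "real \<Rightarrow> (real^'n \<Rightarrow> real^'d^'d) set" where
  "Bp_class p = {V. matrix_weight V \<and> locally_Lp p V \<and> (\<exists>C. Bp_constant p V C)}"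

text \<open>The integrability hypothesis says that \<open>V(E)\<close> exists as a matrix; without it the Bochner
  integral would be the junk value 0 for sets \<open>E\<close> of infinite mass. No set of positive measure
  escapes the condition when \<open>V\<close> is locally integrable, as its bounded parts are covered.\<close>

definition ND_class :: "(real^'n \<Rightarrow> real^'d^'d) set" where
  "ND_class = {V. \<forall>E \<in> sets lebesgue. 0 < emeasure lebesgue E \<longrightarrow> set_integrable lebesgue E V
     \<longrightarrow> pd_matrix (weight_mass V E)}"

text \<open>For open \<open>Q\<close>; only the values of \<open>u\<close> on \<open>Q\<close> matter.\<close>

definition C1_on :: "(real^'n) set \<Rightarrow> (real^'n \<Rightarrow> real^'d) \<Rightarrow> bool" where
  "C1_on Q u \<longleftrightarrow> (\<forall>x\<in>Q. u differentiable (at x)) \<and> continuous_on Q (\<lambda>x. jacobian u (at x))"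

end

theory Submission
  imports Defs
begin

text \<open>
  Put \<open>W = V(Q)\<close>. The operator norm of \<open>W\<^bsup>-1/2\<^esup> V(y)\<^bsup>1/2\<^esup>\<close>, squared, is at most the trace of
  \<open>W\<^bsup>-1/2\<^esup> V(y) W\<^bsup>-1/2\<^esup>\<close>, that is, a sum of \<open>d\<close> scalar weights \<open>g(y) = \<langle>V(y) f, f\<rangle>\<close> with
  \<open>\<langle>W f, f\<rangle> = 1\<close> (\<open>norm_normalised_sqrt_le\<close>). For such an \<open>f\<close> the reverse Hoelder condition bounds
  the \<open>L\<^bsup>n/2\<^esup>\<close> norm of \<open>g\<close> on \<open>Q\<close> by \<open>C\<^sub>V |Q|\<^bsup>2/n-1\<^esup>\<close> (\<open>reverse_hoelder_normalised\<close>). So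
  everything reduces to one scalar inequality, applied to each weight \<open>g\<close> and to each component of
  the vector function: the integral of \<open>g(y) (u(x) - u(y))\<^sup>2\<close> over \<open>Q \<times> Q\<close> is at most a dimensional
  constant times the \<open>L\<^bsup>n/2\<^esup>\<close> norm of \<open>g\<close>, times \<open>|Q|\<close>, times the integral of \<open>|\<nabla>u|\<^sup>2\<close>
  (\<open>weighted_poincare_open_cube\<close>).

  The exponent \<open>n/2\<close> is dual to the critical Sobolev exponent \<open>2n/(n-2)\<close>, so the scalar inequality
  needs the endpoint Sobolev inequality on a cube of side \<open>r\<close>. It is obtained by Gagliardo's method.
  On a line parallel to an axis a nonnegative \<open>v\<close> is bounded by the integral of \<open>v/r + |\<partial>v|\<close>; the
  product of the \<open>n\<close> bounds, integrated one variable at a time with Hoelder's inequality, gives the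
  case of exponent 1 (\<open>gagliardo_nirenberg_cube\<close>). It is applied to \<open>v = |u - c|\<^sup>\<gamma>\<close> with
  \<open>\<gamma> = 2(n-1)/(n-2)\<close>, and the Cauchy-Schwarz inequality and a division yield exponent 2, with the
  lower order term \<open>|u - c|/r\<close> (\<open>sobolev_weighted_cube\<close>). The constant \<open>c\<close> is arbitrary; taking
  \<open>c = u(x)\<close> and integrating in \<open>x\<close> turns the lower order term into the integral of
  \<open>(u(x) - u(y))\<^sup>2/r\<^sup>2\<close> over the product, which the ordinary \<open>L\<^sup>2\<close> Poincare inequality controls
  (\<open>poincare_double_cube\<close>). The division requires a finite \<open>L\<^bsup>2n/(n-2)\<^esup>\<close> norm. It is finite
  on closed cubes inside \<open>Q\<close>, and these exhaust \<open>Q\<close>.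

  All exponents are handled through integer powers of integrals with values in \<open>[0, \<infinity>]\<close>: a
  generalised Hoelder inequality \<open>\<integral>h \<le> (\<integral>f\<^sub>1)\<^bsup>1/m\<^esup> \<cdots> (\<integral>f\<^sub>m)\<^bsup>1/m\<^esup>\<close> is stated as
  \<open>(\<integral>h)\<^sup>m \<le> \<integral>f\<^sub>1 \<cdots> \<integral>f\<^sub>m\<close>, so no roots of extended reals occur.
\<close>

section \<open>Hoelder's inequality for integer powers\<close>

lemma prod_le_mean_power:
  fixes t :: "'i \<Rightarrow> real"
  assumes "finite J" "J \<noteq> {}" "\<And>j. j \<in> J \<Longrightarrow> 0 \<le> t j"
  shows "(\<Prod>j\<in>J. t j) \<le> ((\<Sum>j\<in>J. t j) / card J) ^ card J"
proof -
  have *: "root (card J) (\<Prod>j\<in>J. t j) \<le> (\<Sum>j\<in>J. t j) / card J"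
    using arith_geom_mean[of J t] assms
    by (subst root_powr_inverse) (auto simp: sum_divide_distrib card_gt_0_iff intro!: prod_nonneg)
  have c: "card J > 0" using assms by (simp add: card_gt_0_iff)
  have "0 \<le> (\<Prod>j\<in>J. t j)" using assms by (intro prod_nonneg) auto
  then have "(\<Prod>j\<in>J. t j) = root (card J) (\<Prod>j\<in>J. t j) ^ card J" using c by simp
  also have "\<dots> \<le> ((\<Sum>j\<in>J. t j) / card J) ^ card J"
    by (intro power_mono * real_root_ge_zero) fact
  finally show ?thesis .
qed

lemma ennreal_power_le_cancel:
  fixes a b :: ennreal
  assumes "a ^ n \<le> b ^ n" "0 < n"
  shows "a \<le> b"
proof (cases a; cases b)
  fix r s :: real assume "a = ennreal r" "0 \<le> r" "b = ennreal s" "0 \<le> s"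
  then show ?thesis using assms by (simp add: ennreal_power)
next
  fix r :: real assume "b = ennreal r" "0 \<le> r" "a = top"
  then show ?thesis using assms by (simp add: ennreal_power top_power_ennreal top_unique)
qed (use assms in auto)

text \<open>Hoelder's inequality with \<open>m = card J\<close> equal exponents \<open>1/m\<close>. After normalising every \<open>f\<^sub>j\<close> to
  integral 1 it is the inequality between geometric and arithmetic mean under the integral. The
  constant \<open>c\<close>, possibly infinite, stands for a factor that does not depend on the integration
  variable; the convention \<open>0 \<cdot> \<infinity> = 0\<close> is harmless because a vanishing factor forces \<open>h = 0\<close>
  almost everywhere.\<close>

lemma hoelder_power:
  fixes h :: "'x \<Rightarrow> ennreal" and f :: "'i \<Rightarrow> 'x \<Rightarrow> ennreal"
  assumes J: "finite J" "J \<noteq> {}" and [measurable]: "h \<in> borel_measurable M"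
    and f[measurable]: "\<And>j. j \<in> J \<Longrightarrow> f j \<in> borel_measurable M"
    and le: "\<And>x. x \<in> space M \<Longrightarrow> h x ^ card J \<le> c * (\<Prod>j\<in>J. f j x)"
  shows "(\<integral>\<^sup>+x. h x \<partial>M) ^ card J \<le> c * (\<Prod>j\<in>J. \<integral>\<^sup>+x. f j x \<partial>M)"
proof -
  define m where "m = card J"
  have m: "m > 0" using J by (simp add: m_def card_gt_0_iff)
  define a where "a j = (\<integral>\<^sup>+x. f j x \<partial>M)" for j
  consider (z) "c = 0" | (zj) j where "j \<in> J" "a j = 0"
    | (inf) "c \<noteq> 0" "\<And>j. j \<in> J \<Longrightarrow> a j \<noteq> 0" "c = \<infinity> \<or> (\<exists>j\<in>J. a j = \<infinity>)"
    | (fin) "0 < c" "c < \<infinity>" "\<And>j. j \<in> J \<Longrightarrow> 0 < a j \<and> a j < \<infinity>"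
    by (metis infinity_ennreal_def not_gr_zero top.not_eq_extremum)
  then show ?thesis
  proof cases
    case z
    then have "h x = 0" if "x \<in> space M" for x using le[OF that] m by (simp add: m_def)
    then have "(\<integral>\<^sup>+x. h x \<partial>M) = 0" by (simp cong: nn_integral_cong)
    then show ?thesis using m by (simp add: m_def[symmetric] zero_power)
  next
    case zj
    then have "AE x in M. f j x = 0" unfolding a_def by (subst (asm) nn_integral_0_iff_AE) auto
    then have "AE x in M. h x = 0"
      using AE_space
    proof eventually_elim
      case (elim x)
      then have *: "(\<Prod>j\<in>J. f j x) = 0" using zj J by auto
      show ?case using le[OF elim(2)] m * by (simp add: m_def)
    qed
    then have "(\<integral>\<^sup>+x. h x \<partial>M) = 0" by (subst nn_integral_0_iff_AE) auto
    then show ?thesis using m by (simp add: m_def[symmetric] zero_power)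
  next
    case inf
    then have "c * (\<Prod>j\<in>J. a j) = \<infinity>"
      using J by (auto simp: ennreal_mult_eq_top_iff ennreal_prod_eq_top)
    then show ?thesis by (simp add: a_def)
  next
    case fin
    define b where "b = root m (enn2real (c * (\<Prod>j\<in>J. a j)))"
    have "(\<Prod>j\<in>J. a j) = (\<Prod>j\<in>J. ennreal (enn2real (a j)))"
      using fin(3) by (intro prod.cong) auto
    then have cfin: "c * (\<Prod>j\<in>J. a j) < \<infinity>"
      using fin(2) by (simp add: prod_ennreal ennreal_mult_less_top)
    have b0: "0 \<le> b" using m by (simp add: b_def real_root_ge_zero)
    have bm: "ennreal b ^ m = c * (\<Prod>j\<in>J. a j)"
      using m cfin by (simp add: b_def ennreal_power)
    have pt: "h x \<le> ennreal (b / m) * (\<Sum>j\<in>J. f j x / a j)" if x: "x \<in> space M" for x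
    proof (cases "\<exists>j\<in>J. f j x = \<infinity>")
      case True
      then obtain j where j: "j \<in> J" "f j x = \<infinity>" by auto
      then have "f j x / a j = \<infinity>"
        using fin(3)[of j] by (auto simp: ennreal_top_divide less_top[symmetric])
      then have "(\<Sum>j\<in>J. f j x / a j) = \<infinity>"
        using J j(1) by (auto simp: ennreal_sum_eq_top)
      moreover have "b > 0"
      proof (rule ccontr)
        assume "\<not> b > 0"
        then have "b = 0" using b0 by simp
        then have "c * (\<Prod>j\<in>J. a j) = 0" using bm m by (simp add: zero_power)
        then show False using fin by (auto simp: less_le)
      qed
      ultimately show ?thesis using m by (simp add: ennreal_mult_top)
    next
      case False
      define t where "t j = enn2real (f j x / a j)" for j
      have t: "f j x = ennreal (t j) * a j" "ennreal (t j) = f j x / a j" if "j \<in> J" for j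
      proof -
        have "\<exists>\<alpha>>0. a j = ennreal \<alpha>"
          using fin(3)[OF that] by (cases "a j") auto
        then obtain \<alpha> where \<alpha>: "0 < \<alpha>" "a j = ennreal \<alpha>" by blast
        have "\<exists>\<phi>\<ge>0. f j x = ennreal \<phi>"
          using False that by (cases "f j x") auto
        then obtain \<phi> where \<phi>: "0 \<le> \<phi>" "f j x = ennreal \<phi>" by blast
        have "f j x / a j = ennreal (\<phi> / \<alpha>)" using \<alpha> \<phi> by (simp add: divide_ennreal)
        moreover have "0 \<le> \<phi> / \<alpha>" using \<alpha> \<phi> by simp
        ultimately have tj: "t j = \<phi> / \<alpha>" by (simp add: t_def)
        show "f j x = ennreal (t j) * a j"
          unfolding tj \<alpha>(2) \<phi>(2) using \<alpha> \<phi> by (simp add: ennreal_mult[symmetric])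
        show "ennreal (t j) = f j x / a j" by (simp add: tj \<open>f j x / a j = _\<close>)
      qed
      have t0: "0 \<le> t j" for j by (simp add: t_def)
      then have mean0: "0 \<le> (\<Sum>j\<in>J. t j) / m" by (simp add: sum_nonneg)
      have "h x ^ m \<le> c * (\<Prod>j\<in>J. ennreal (t j) * a j)"
        using le[OF x] t(1) unfolding m_def by (simp only: prod.cong[OF refl t(1)])
      also have "\<dots> = ennreal b ^ m * ennreal (\<Prod>j\<in>J. t j)"
        unfolding bm prod.distrib by (simp add: prod_ennreal t0 mult_ac)
      also have "\<dots> \<le> ennreal b ^ m * ennreal (((\<Sum>j\<in>J. t j) / m) ^ m)"
        unfolding m_def by (intro mult_left_mono ennreal_leI prod_le_mean_power J t0) auto
      also have "\<dots> = ennreal (b * ((\<Sum>j\<in>J. t j) / m)) ^ m"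
        using b0 mean0 by (simp only: ennreal_mult power_mult_distrib ennreal_power)
      finally have "h x \<le> ennreal (b * ((\<Sum>j\<in>J. t j) / m))"
        using m ennreal_power_le_cancel by blast
      also have "\<dots> = ennreal (b / m) * (\<Sum>j\<in>J. ennreal (t j))"
        using b0 t0 by (simp add: ennreal_mult[symmetric] sum_nonneg)
      also have "\<dots> = ennreal (b / m) * (\<Sum>j\<in>J. f j x / a j)"
        using t by simp
      finally show ?thesis .
    qed
    have "(\<integral>\<^sup>+x. h x \<partial>M) \<le> (\<integral>\<^sup>+x. ennreal (b / m) * (\<Sum>j\<in>J. f j x / a j) \<partial>M)"
      by (intro nn_integral_mono pt)
    also have "\<dots> = ennreal (b / m) * (\<Sum>j\<in>J. (\<integral>\<^sup>+x. f j x / a j \<partial>M))"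
      by (subst nn_integral_cmult) (auto simp: nn_integral_sum divide_ennreal_def)
    also have "(\<Sum>j\<in>J. (\<integral>\<^sup>+x. f j x / a j \<partial>M)) = (\<Sum>j\<in>J. 1)"
    proof (intro sum.cong refl)
      fix j assume j: "j \<in> J"
      then have "(\<integral>\<^sup>+x. f j x / a j \<partial>M) = a j / a j" by (simp add: nn_integral_divide a_def)
      then show "(\<integral>\<^sup>+x. f j x / a j \<partial>M) = 1" using ennreal_divide_self[of "a j"] fin(3)[OF j] by auto
    qed
    also have "\<dots> = of_nat m" by (simp add: m_def)
    also have "ennreal (b / m) * of_nat m = ennreal b"
      using m b0 by (simp add: ennreal_of_nat_eq_real_of_nat ennreal_mult[symmetric])
    finally have "(\<integral>\<^sup>+x. h x \<partial>M) ^ m \<le> ennreal b ^ m" by (intro power_mono) auto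
    then show ?thesis unfolding bm by (simp add: a_def m_def)
  qed
qed

section \<open>Gagliardo's inequality\<close>

context product_sigma_finite
begin

text \<open>Integration over the coordinates in \<open>S\<close> only. The result stays a function of all coordinates,
  constant in those of \<open>S\<close>, so that integrals over different sets of coordinates can be compared
  without changing the domain.\<close>

definition partial_integral :: "'i set \<Rightarrow> (('i \<Rightarrow> 'a) \<Rightarrow> ennreal) \<Rightarrow> ('i \<Rightarrow> 'a) \<Rightarrow> ennreal" where
  "partial_integral S f x = (\<integral>\<^sup>+z. f (override_on x z S) \<partial>Pi\<^sub>M S M)"

lemma measurable_override_on:
  assumes "S \<subseteq> I"
  shows "(\<lambda>(x, z). override_on x z S) \<in> Pi\<^sub>M I M \<Otimes>\<^sub>M Pi\<^sub>M S M \<rightarrow>\<^sub>M Pi\<^sub>M I M"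
proof (rule measurable_PiM_single')
  fix i assume i: "i \<in> I"
  show "(\<lambda>p. (case p of (x, z) \<Rightarrow> override_on x z S) i) \<in> Pi\<^sub>M I M \<Otimes>\<^sub>M Pi\<^sub>M S M \<rightarrow>\<^sub>M M i"
    using i by (cases "i \<in> S") (auto simp: split_beta override_on_def)
next
  show "(\<lambda>p i. (case p of (x, z) \<Rightarrow> override_on x z S) i) \<in> space (Pi\<^sub>M I M \<Otimes>\<^sub>M Pi\<^sub>M S M) \<rightarrow> (\<Pi>\<^sub>E i\<in>I. space (M i))"
    using assms by (fastforce simp: space_pair_measure space_PiM override_on_def PiE_def extensional_def Pi_def)
qed

lemma measurable_partial_integral:
  assumes I: "finite I" "S \<subseteq> I" and f: "f \<in> borel_measurable (Pi\<^sub>M I M)"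
  shows "partial_integral S f \<in> borel_measurable (Pi\<^sub>M I M)"
proof -
  interpret S: finite_product_sigma_finite M S
    using I by unfold_locales (auto intro: finite_subset)
  have "(\<lambda>p. f (case p of (x, z) \<Rightarrow> override_on x z S)) \<in> borel_measurable (Pi\<^sub>M I M \<Otimes>\<^sub>M Pi\<^sub>M S M)"
    by (rule measurable_compose[OF measurable_override_on[OF I(2)] f])
  then show ?thesis unfolding partial_integral_def
    by (intro S.borel_measurable_nn_integral) (simp add: split_beta)
qed

lemma partial_integral_empty:
  "partial_integral {} f x = f x"
  unfolding partial_integral_def
  by (subst nn_integral_empty) simp_all

lemma partial_integral_insert:
  assumes I: "finite I" "insert k S \<subseteq> I" "k \<notin> S" and f: "f \<in> borel_measurable (Pi\<^sub>M I M)"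
    and x: "x \<in> space (Pi\<^sub>M I M)"
  shows "partial_integral (insert k S) f x = (\<integral>\<^sup>+t. partial_integral S f (x(k := t)) \<partial>M k)"
proof -
  have S: "finite S" using I by (auto intro: finite_subset)
  have "(\<lambda>z. override_on x z (insert k S)) \<in> Pi\<^sub>M (insert k S) M \<rightarrow>\<^sub>M Pi\<^sub>M I M"
    using measurable_compose[OF measurable_Pair1'[OF x] measurable_override_on[OF I(2)]] by simp
  from measurable_compose[OF this f]
  have "partial_integral (insert k S) f x
      = (\<integral>\<^sup>+t. (\<integral>\<^sup>+z. f (override_on x (z(k := t)) (insert k S)) \<partial>Pi\<^sub>M S M) \<partial>M k)"
    unfolding partial_integral_def
    by (intro product_nn_integral_insert_rev S I)
  moreover have "override_on x (z(k := t)) (insert k S) = override_on (x(k := t)) z S" for z t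
    using I(3) by (auto simp: override_on_def fun_eq_iff)
  ultimately show ?thesis by (simp add: partial_integral_def)
qed

lemma partial_integral_upd:
  assumes "k \<in> S"
  shows "partial_integral S f (x(k := t)) = partial_integral S f x"
proof -
  have "override_on (x(k := t)) z S = override_on x z S" for z
    using assms by (auto simp: override_on_def fun_eq_iff)
  then show ?thesis by (simp add: partial_integral_def)
qed

lemma partial_integral_full:
  assumes "x \<in> space (Pi\<^sub>M I M)"
  shows "partial_integral I f x = (\<integral>\<^sup>+z. f z \<partial>Pi\<^sub>M I M)"
proof -
  have "override_on x z I = z" if "z \<in> space (Pi\<^sub>M I M)" for z
    using that assms by (auto simp: override_on_def fun_eq_iff space_PiM PiE_def extensional_def)
  then show ?thesis by (simp add: partial_integral_def cong: nn_integral_cong)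
qed

text \<open>The induction behind Gagliardo's inequality. When a further coordinate \<open>k\<close> is integrated, the
  \<open>k\<close>-th factor is already constant in it (\<open>partial_integral_upd\<close>), and the remaining \<open>card I - 1\<close>
  factors are exactly as many as Hoelder's inequality needs for the power on the left. Writing the
  \<open>i\<close>-th factor with \<open>insert i S\<close> covers \<open>i \<in> S\<close> and \<open>i \<notin> S\<close> by the same expression.\<close>

lemma gagliardo_partial:
  assumes I: "finite I" "2 \<le> card I"
    and F[measurable]: "F \<in> borel_measurable (Pi\<^sub>M I M)"
    and G[measurable]: "\<And>i. i \<in> I \<Longrightarrow> G i \<in> borel_measurable (Pi\<^sub>M I M)"
    and le: "\<And>x. x \<in> space (Pi\<^sub>M I M) \<Longrightarrow> F x ^ (card I - 1) \<le> (\<Prod>i\<in>I. \<integral>\<^sup>+t. G i (x(i := t)) \<partial>M i)"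
    and S: "S \<subseteq> I" and x: "x \<in> space (Pi\<^sub>M I M)"
  shows "partial_integral S F x ^ (card I - 1) \<le> (\<Prod>i\<in>I. partial_integral (insert i S) (G i) x)"
  using finite_subset[OF S I(1)] S x
proof (induction S arbitrary: x rule: finite_induct)
  case empty
  have "partial_integral {i} (G i) x = (\<integral>\<^sup>+t. G i (x(i := t)) \<partial>M i)" if "i \<in> I" for i
    using partial_integral_insert[of I i "{}" "G i" x] I(1) that G[OF that] empty
    by (simp add: partial_integral_empty)
  then show ?case using le[OF empty(2)] by (simp add: partial_integral_empty)
next
  case (insert k S)
  then have k: "k \<in> I" "S \<subseteq> I" by auto
  have upd: "x(k := t) \<in> space (Pi\<^sub>M I M)" if "t \<in> space (M k)" for t
    using insert.prems(2) k that by (auto simp: space_PiM PiE_def extensional_def Pi_def)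
  have [measurable]: "(\<lambda>t. x(k := t)) \<in> M k \<rightarrow>\<^sub>M Pi\<^sub>M I M"
  proof -
    have "(\<lambda>t. x(k := t)) \<in> M k \<rightarrow>\<^sub>M Pi\<^sub>M (insert k I) M"
      using insert.prems(2) by (intro measurable_fun_upd[where J=I]) auto
    then show ?thesis using k by (simp add: insert_absorb)
  qed
  have mF: "(\<lambda>t. partial_integral S F (x(k := t))) \<in> borel_measurable (M k)"
    by (rule measurable_compose[OF _ measurable_partial_integral[OF I(1) k(2) F]]) measurable
  have mG: "(\<lambda>t. partial_integral (insert i S) (G i) (x(k := t))) \<in> borel_measurable (M k)" if "i \<in> I" for i
    by (rule measurable_compose[OF _ measurable_partial_integral[OF I(1) _ G[OF that]]])
       (use that k in auto)
  let ?J = "I - {k}"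
  have card: "card ?J = card I - 1" using I k by simp
  have J: "finite ?J" "?J \<noteq> {}"
    using I k card_gt_0_iff[of ?J] by (simp_all add: card del: card_Diff_insert)
  have "(\<integral>\<^sup>+t. partial_integral S F (x(k := t)) \<partial>M k) ^ card ?J
     \<le> partial_integral (insert k S) (G k) x * (\<Prod>i\<in>?J. \<integral>\<^sup>+t. partial_integral (insert i S) (G i) (x(k := t)) \<partial>M k)"
  proof (rule hoelder_power[OF J mF mG])
    fix t assume "t \<in> space (M k)"
    from insert.IH[OF k(2) upd[OF this]]
    have "partial_integral S F (x(k := t)) ^ (card I - 1)
       \<le> (\<Prod>i\<in>I. partial_integral (insert i S) (G i) (x(k := t)))" .
    also have "\<dots> = partial_integral (insert k S) (G k) (x(k := t)) * (\<Prod>i\<in>?J. partial_integral (insert i S) (G i) (x(k := t)))"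
      using I k by (simp add: prod.remove)
    finally show "partial_integral S F (x(k := t)) ^ card ?J \<le> partial_integral (insert k S) (G k) x
        * (\<Prod>i\<in>?J. partial_integral (insert i S) (G i) (x(k := t)))"
      by (simp add: card partial_integral_upd)
  qed auto
  also have "(\<Prod>i\<in>?J. \<integral>\<^sup>+t. partial_integral (insert i S) (G i) (x(k := t)) \<partial>M k)
      = (\<Prod>i\<in>?J. partial_integral (insert i (insert k S)) (G i) x)"
  proof (rule prod.cong[OF refl])
    fix i assume i: "i \<in> ?J"
    then show "(\<integral>\<^sup>+t. partial_integral (insert i S) (G i) (x(k := t)) \<partial>M k)
        = partial_integral (insert i (insert k S)) (G i) x"
      using partial_integral_insert[of I k "insert i S" "G i" x] I(1) G[of i] insert k
      by (auto simp add: insert_commute)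
  qed
  also have "partial_integral (insert k S) (G k) x * (\<Prod>i\<in>?J. partial_integral (insert i (insert k S)) (G i) x)
      = (\<Prod>i\<in>I. partial_integral (insert i (insert k S)) (G i) x)"
    using I k by (simp add: prod.remove)
  also have "(\<integral>\<^sup>+t. partial_integral S F (x(k := t)) \<partial>M k) = partial_integral (insert k S) F x"
    using partial_integral_insert[of I k S F x] I(1) insert by simp
  finally show ?case by (simp add: card)
qed

lemma gagliardo_product:
  assumes I: "finite I" "2 \<le> card I"
    and F[measurable]: "F \<in> borel_measurable (Pi\<^sub>M I M)"
    and G[measurable]: "\<And>i. i \<in> I \<Longrightarrow> G i \<in> borel_measurable (Pi\<^sub>M I M)"
    and le: "\<And>x. x \<in> space (Pi\<^sub>M I M) \<Longrightarrow> F x ^ (card I - 1) \<le> (\<Prod>i\<in>I. \<integral>\<^sup>+t. G i (x(i := t)) \<partial>M i)"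
    and ne: "space (Pi\<^sub>M I M) \<noteq> {}"
  shows "(\<integral>\<^sup>+x. F x \<partial>Pi\<^sub>M I M) ^ (card I - 1) \<le> (\<Prod>i\<in>I. \<integral>\<^sup>+x. G i x \<partial>Pi\<^sub>M I M)"
proof -
  obtain x where x: "x \<in> space (Pi\<^sub>M I M)" using ne by blast
  have "partial_integral I F x ^ (card I - 1) \<le> (\<Prod>i\<in>I. partial_integral (insert i I) (G i) x)"
    by (rule gagliardo_partial[OF I F G le subset_refl x])
  then show ?thesis by (simp add: partial_integral_full[OF x] insert_absorb cong: prod.cong)
qed

end

text \<open>The Loomis-Whitney type inequality of Gagliardo: the coordinates of a Euclidean space are the
  factors of a product measure, and \<open>x + (t - x \<bullet> i) i\<close> is \<open>x\<close> with its \<open>i\<close>-th coordinate replaced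
  by \<open>t\<close>.\<close>

lemma gagliardo_lborel:
  fixes F :: "'a::euclidean_space \<Rightarrow> ennreal"
  assumes n: "2 \<le> DIM('a)"
    and F[measurable]: "F \<in> borel_measurable borel"
    and G[measurable]: "\<And>i. i \<in> Basis \<Longrightarrow> G i \<in> borel_measurable borel"
    and le: "\<And>x. F x ^ (DIM('a) - 1) \<le> (\<Prod>i\<in>Basis. \<integral>\<^sup>+t. G i (x + (t - x \<bullet> i) *\<^sub>R i) \<partial>lborel)"
  shows "(\<integral>\<^sup>+x. F x \<partial>lborel) ^ (DIM('a) - 1) \<le> (\<Prod>i\<in>Basis. \<integral>\<^sup>+x. G i x \<partial>lborel)"
proof -
  interpret product_sigma_finite "\<lambda>_::'a. lborel::real measure"
    by unfold_locales
  define \<sigma> where "\<sigma> z = (\<Sum>b\<in>Basis. z b *\<^sub>R b)" for z :: "'a \<Rightarrow> real"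
  have [measurable]: "\<sigma> \<in> Pi\<^sub>M Basis (\<lambda>_. lborel) \<rightarrow>\<^sub>M borel"
    unfolding \<sigma>_def by measurable
  have lb: "lborel = distr (Pi\<^sub>M Basis (\<lambda>_. lborel)) borel \<sigma>"
    unfolding \<sigma>_def by (rule lborel_eq)
  have int: "(\<integral>\<^sup>+x. f x \<partial>lborel) = (\<integral>\<^sup>+z. f (\<sigma> z) \<partial>Pi\<^sub>M Basis (\<lambda>_. lborel))"
    if [measurable]: "f \<in> borel_measurable borel" for f :: "'a \<Rightarrow> ennreal"
    by (subst lb, subst nn_integral_distr) auto
  have upd: "\<sigma> (z(i := t)) = \<sigma> z + (t - \<sigma> z \<bullet> i) *\<^sub>R i" if i: "i \<in> Basis" for z i t
  proof -
    have "\<sigma> z \<bullet> i = z i" using i by (simp add: \<sigma>_def inner_sum_left inner_Basis if_distrib cong: if_cong)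
    moreover have "\<sigma> w = w i *\<^sub>R i + (\<Sum>b\<in>Basis - {i}. w b *\<^sub>R b)" for w
      using i by (simp add: \<sigma>_def sum.remove)
    moreover have "(\<Sum>b\<in>Basis - {i}. (z(i := t)) b *\<^sub>R b) = (\<Sum>b\<in>Basis - {i}. z b *\<^sub>R b)"
      by (intro sum.cong) auto
    ultimately show ?thesis by (simp add: scaleR_left_diff_distrib)
  qed
  have "(\<integral>\<^sup>+z. F (\<sigma> z) \<partial>Pi\<^sub>M Basis (\<lambda>_. lborel)) ^ (DIM('a) - 1)
      \<le> (\<Prod>i\<in>Basis. \<integral>\<^sup>+z. G i (\<sigma> z) \<partial>Pi\<^sub>M Basis (\<lambda>_. lborel))"
  proof (rule gagliardo_product[OF finite_Basis n])
    fix z :: "'a \<Rightarrow> real"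
    show "F (\<sigma> z) ^ (DIM('a) - 1) \<le> (\<Prod>i\<in>Basis. \<integral>\<^sup>+t. G i (\<sigma> (z(i := t))) \<partial>lborel)"
      using le[of "\<sigma> z"] by (simp add: upd cong: prod.cong)
  qed (use G in \<open>auto simp: space_PiM PiE_eq_empty_iff\<close>)
  then show ?thesis using int[OF F] int[OF G] by (simp cong: prod.cong)
qed

section \<open>The Gagliardo-Nirenberg inequality on a cube\<close>

text \<open>The minimum of \<open>f\<close> is at most its mean value, and \<open>f\<close> exceeds its minimum by at most its total
  variation. The mean value replaces the boundary condition of the Gagliardo-Nirenberg inequality
  for compactly supported functions.\<close>

lemma le_mean_plus_variation:
  fixes f f' :: "real \<Rightarrow> real"
  assumes r: "0 < r"
    and f: "\<And>t. t \<in> {c..c+r} \<Longrightarrow> (f has_real_derivative f' t) (at t within {c..c+r})"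
    and f': "continuous_on {c..c+r} f'"
    and nonneg: "\<And>t. t \<in> {c..c+r} \<Longrightarrow> 0 \<le> f t"
    and t: "t \<in> {c..c+r}"
  shows "ennreal (f t) \<le> (\<integral>\<^sup>+s. ennreal (f s / r + \<bar>f' s\<bar>) * indicator {c..c+r} s \<partial>lborel)"
proof -
  have cf: "continuous_on {c..c+r} f"
    using f by (meson DERIV_continuous continuous_on_eq_continuous_within)
  obtain s where s: "s \<in> {c..c+r}" and smin: "\<And>y. y \<in> {c..c+r} \<Longrightarrow> f s \<le> f y"
    using continuous_attains_inf[of "{c..c+r}" f] r cf by auto
  have i1: "(\<lambda>y. f y / r) integrable_on {c..c+r}"
    by (intro integrable_continuous_real continuous_intros cf) (use r in auto)
  have i2: "(\<lambda>y. \<bar>f' y\<bar>) integrable_on {c..c+r}"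
    by (intro integrable_continuous_real continuous_intros f')
  have "f s = integral {c..c+r} (\<lambda>y. f s / r)" using r by simp
  also have "\<dots> \<le> integral {c..c+r} (\<lambda>y. f y / r)"
    using r by (intro integral_le i1) (auto intro!: divide_right_mono smin)
  finally have 1: "f s \<le> integral {c..c+r} (\<lambda>y. f y / r)" .
  have variation: "\<bar>f y - f x\<bar> \<le> integral {c..c+r} (\<lambda>y. \<bar>f' y\<bar>)" if "x \<in> {c..c+r}" "y \<in> {c..c+r}" "x \<le> y" for x y
  proof -
    have sub: "{x..y} \<subseteq> {c..c+r}" using that by auto
    have "(f' has_integral (f y - f x)) {x..y}"
      using that sub by (intro fundamental_theorem_of_calculus)
        (auto simp: has_real_derivative_iff_has_vector_derivative[symmetric] intro!: DERIV_subset[OF f])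
    then have "f y - f x = integral {x..y} f'" by (simp add: integral_unique)
    also have "\<bar>\<dots>\<bar> \<le> integral {x..y} (\<lambda>y. \<bar>f' y\<bar>)"
      using continuous_on_subset[OF f' sub]
      by (subst real_norm_def[symmetric], intro integral_norm_bound_integral integrable_continuous_real continuous_intros) auto
    also have "\<dots> \<le> integral {c..c+r} (\<lambda>y. \<bar>f' y\<bar>)"
      using sub i2 by (intro integral_subset_le) (auto intro: integrable_subinterval_real)
    finally show ?thesis .
  qed
  have 2: "f t - f s \<le> integral {c..c+r} (\<lambda>y. \<bar>f' y\<bar>)"
    using variation[of s t] variation[of t s] s t by linarith
  have "((\<lambda>s. f s / r + \<bar>f' s\<bar>) has_integral
      integral {c..c+r} (\<lambda>y. f y / r) + integral {c..c+r} (\<lambda>y. \<bar>f' y\<bar>)) {c..c+r}"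
    using i1 i2 by (intro has_integral_add integrable_integral)
  then have "(\<integral>\<^sup>+s. ennreal (f s / r + \<bar>f' s\<bar>) * indicator {c..c+r} s \<partial>lborel)
     = ennreal (integral {c..c+r} (\<lambda>y. f y / r) + integral {c..c+r} (\<lambda>y. \<bar>f' y\<bar>))"
    using nonneg r by (intro nn_integral_has_integral_lebesgue') auto
  then show ?thesis using 1 2 by (auto intro!: ennreal_leI)
qed

lemma mem_cube:
  fixes x :: "'a::euclidean_space"
  shows "x \<in> cbox a (a + r *\<^sub>R One) \<longleftrightarrow> (\<forall>b\<in>Basis. a \<bullet> b \<le> x \<bullet> b \<and> x \<bullet> b \<le> a \<bullet> b + r)"
  by (simp add: mem_box inner_simps)

lemma inner_move_coordinate:
  fixes x :: "'a::euclidean_space"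
  assumes "i \<in> Basis" "b \<in> Basis"
  shows "(x + (t - x \<bullet> i) *\<^sub>R i) \<bullet> b = (if b = i then t else x \<bullet> b)"
  using assms by (auto simp: inner_simps inner_Basis)

lemma move_coordinate_mem_cube:
  fixes x :: "'a::euclidean_space"
  assumes x: "x \<in> cbox a (a + r *\<^sub>R One)" and i: "i \<in> Basis"
  shows "x + (t - x \<bullet> i) *\<^sub>R i \<in> cbox a (a + r *\<^sub>R One) \<longleftrightarrow> t \<in> {a \<bullet> i..a \<bullet> i + r}"
  using assms by (auto simp: mem_cube inner_move_coordinate[OF i])

lemma borel_indicator_continuous:
  fixes f :: "'a::euclidean_space \<Rightarrow> real"
  assumes "continuous_on K f" "K \<in> sets borel"
  shows "(\<lambda>x. ennreal (f x) * indicator K x) \<in> borel_measurable borel"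
proof -
  have "(\<lambda>x. indicator K x *\<^sub>R f x) \<in> borel_measurable borel"
    using assms by (intro borel_measurable_continuous_on_indicator)
  then have "(\<lambda>x. ennreal (indicator K x *\<^sub>R f x)) \<in> borel_measurable borel" by measurable
  also have "(\<lambda>x. ennreal (indicator K x *\<^sub>R f x)) = (\<lambda>x. ennreal (f x) * indicator K x)"
    by (auto simp: indicator_def)
  finally show ?thesis .
qed

text \<open>The one-dimensional bound along each of the \<open>n\<close> coordinate directions gives \<open>n\<close> bounds for
  \<open>v(x)\<close>, the \<open>i\<close>-th one constant in the \<open>i\<close>-th coordinate; their product is the input of Gagliardo's
  inequality. With \<open>F = v\<^bsup>n/(n-1)\<^esup>\<close> this is the embedding of \<open>W\<^bsup>1,1\<^esup>\<close> into \<open>L\<^bsup>n/(n-1)\<^esup>\<close>; \<open>F\<close> enters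
  only through its integer power.\<close>

lemma gagliardo_nirenberg_cube:
  fixes v :: "'a::euclidean_space \<Rightarrow> real"
  defines "n \<equiv> DIM('a)"
  assumes n: "2 \<le> n" and r: "0 < r" and K: "K = cbox a (a + r *\<^sub>R One)"
    and v: "\<And>x. x \<in> K \<Longrightarrow> (v has_derivative (\<lambda>h. Dv x \<bullet> h)) (at x within K)"
    and Dv: "continuous_on K Dv"
    and nonneg: "\<And>x. x \<in> K \<Longrightarrow> 0 \<le> v x"
    and F[measurable]: "F \<in> borel_measurable borel"
    and le: "\<And>x. x \<in> K \<Longrightarrow> F x ^ (n - 1) \<le> ennreal (v x) ^ n"
  shows "(\<integral>\<^sup>+x\<in>K. F x \<partial>lborel) ^ (n - 1) \<le> (\<integral>\<^sup>+x\<in>K. ennreal (v x / r + norm (Dv x)) \<partial>lborel) ^ n"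
proof -
  have cv: "continuous_on K v"
    using v by (meson has_derivative_continuous continuous_on_eq_continuous_within)
  have [measurable]: "K \<in> sets borel" by (simp add: K)
  define G where "G i x = ennreal (v x / r + \<bar>Dv x \<bullet> i\<bar>) * indicator K x" for i x
  have G: "G i \<in> borel_measurable borel" for i
    unfolding G_def by (intro borel_indicator_continuous continuous_intros cv Dv) (use r in \<open>auto simp: K\<close>)
  have "(\<integral>\<^sup>+x. F x * indicator K x \<partial>lborel) ^ (n - 1) \<le> (\<Prod>i\<in>Basis. \<integral>\<^sup>+x. G i x \<partial>lborel)"
    unfolding n_def
  proof (rule gagliardo_lborel)
    fix x :: 'a
    show "(F x * indicator K x) ^ (DIM('a) - 1) \<le> (\<Prod>i\<in>Basis. \<integral>\<^sup>+t. G i (x + (t - x \<bullet> i) *\<^sub>R i) \<partial>lborel)"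
    proof (cases "x \<in> K")
      case False
      then show ?thesis using n by (simp add: n_def zero_power)
    next
      case x: True
      have line: "ennreal (v x) \<le> (\<integral>\<^sup>+t. G i (x + (t - x \<bullet> i) *\<^sub>R i) \<partial>lborel)" if i: "i \<in> Basis" for i
      proof -
        define L where "L t = x + (t - x \<bullet> i) *\<^sub>R i" for t
        define I where "I = {a \<bullet> i..a \<bullet> i + r}"
        have LK: "L t \<in> K \<longleftrightarrow> t \<in> I" for t
          using move_coordinate_mem_cube[of x a r i t] x i by (simp add: K L_def I_def)
        have Lx: "L (x \<bullet> i) = x" by (simp add: L_def)
        have cL: "continuous_on I L" unfolding L_def by (intro continuous_intros)
        have "ennreal (v (L (x \<bullet> i))) \<le> (\<integral>\<^sup>+t. ennreal (v (L t) / r + \<bar>Dv (L t) \<bullet> i\<bar>) * indicator I t \<partial>lborel)"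
          unfolding I_def
        proof (rule le_mean_plus_variation[OF r], fold I_def)
          fix t assume t: "t \<in> I"
          have "(L has_derivative (\<lambda>h. h *\<^sub>R i)) (at t within I)"
            unfolding L_def by (auto intro!: derivative_eq_intros)
          moreover have "(v has_derivative (\<lambda>h. Dv (L t) \<bullet> h)) (at (L t) within L ` I)"
            by (rule has_derivative_subset[OF v]) (use LK t in auto)
          ultimately have "((\<lambda>t. v (L t)) has_derivative (\<lambda>h. Dv (L t) \<bullet> (h *\<^sub>R i))) (at t within I)"
            by (rule has_derivative_in_compose)
          then show "((\<lambda>t. v (L t)) has_real_derivative (Dv (L t) \<bullet> i)) (at t within I)"
            by (simp add: has_field_derivative_def mult_commute_abs)
          show "0 \<le> v (L t)" using nonneg LK t by auto
        next
          show "continuous_on I (\<lambda>t. Dv (L t) \<bullet> i)"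
            by (intro continuous_intros continuous_on_compose2[OF Dv cL]) (use LK in auto)
          show "x \<bullet> i \<in> I" using LK[of "x \<bullet> i"] Lx x by simp
        qed
        also have "\<dots> = (\<integral>\<^sup>+t. G i (L t) \<partial>lborel)"
          using LK by (intro nn_integral_cong) (auto simp: G_def indicator_def)
        finally show ?thesis by (simp add: Lx) (simp add: L_def)
      qed
      have "(F x * indicator K x) ^ (DIM('a) - 1) \<le> ennreal (v x) ^ n" using le[OF x] x by (simp add: n_def)
      also have "\<dots> = (\<Prod>i\<in>(Basis::'a set). ennreal (v x))" by (simp add: n_def)
      also have "\<dots> \<le> (\<Prod>i\<in>Basis. \<integral>\<^sup>+t. G i (x + (t - x \<bullet> i) *\<^sub>R i) \<partial>lborel)"
        by (intro prod_mono_ennreal line)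
      finally show ?thesis .
    qed
  qed (use n G in \<open>auto simp: n_def\<close>)
  also have "\<dots> \<le> (\<Prod>i\<in>(Basis::'a set). \<integral>\<^sup>+x\<in>K. ennreal (v x / r + norm (Dv x)) \<partial>lborel)"
    by (intro prod_mono_ennreal nn_integral_mono)
      (auto simp: G_def indicator_def intro!: ennreal_leI Basis_le_norm)
  finally show ?thesis by (simp add: n_def)
qed

section \<open>The critical Sobolev inequality, tested against a weight\<close>

text \<open>The derivative is written without the sign function because \<open>|s|\<^bsup>\<gamma>-2\<^esup> s\<close> is visibly continuous
  for \<open>\<gamma> > 2\<close>.\<close>

lemma has_real_derivative_abs_powr:
  fixes \<gamma> :: real
  assumes \<gamma>: "2 < \<gamma>"
  shows "((\<lambda>s. \<bar>s\<bar> powr \<gamma>) has_real_derivative \<gamma> * \<bar>s\<bar> powr (\<gamma> - 2) * s) (at s)"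
proof -
  have pos: "((\<lambda>s. \<bar>s\<bar> powr \<gamma>) has_real_derivative \<gamma> * s powr (\<gamma> - 1)) (at s)" if "0 < s" for s :: real
  proof (rule has_field_derivative_transform_within_open)
    show "((\<lambda>s. s powr \<gamma>) has_real_derivative \<gamma> * s powr (\<gamma> - 1)) (at s)"
      using that by (auto intro!: derivative_eq_intros)
  qed (use that in \<open>auto intro: open_greaterThan[of 0]\<close>)
  consider "s > 0" | "s = 0" | "s < 0" by linarith
  then show ?thesis
  proof cases
    case 1
    then have "s powr (\<gamma> - 1) = s powr (\<gamma> - 2) * s"
      using powr_add[of s "\<gamma> - 2" 1] by simp
    then show ?thesis using pos[OF 1] 1 by (simp add: mult.assoc)
  next
    case 3
    then have "(-s) powr (\<gamma> - 1) = (-s) powr (\<gamma> - 2) * (-s)"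
      using powr_add[of "-s" "\<gamma> - 2" 1] by simp
    moreover have "((\<lambda>s. \<bar>-s\<bar> powr \<gamma>) has_real_derivative \<gamma> * (-s) powr (\<gamma> - 1) * (-1)) (at s)"
      using 3 by (intro DERIV_chain'[OF _ pos]) (auto intro!: derivative_eq_intros)
    moreover have "\<bar>s\<bar> = - s" using 3 by simp
    ultimately show ?thesis by (simp add: mult.assoc)
  next
    case 2
    have "((\<lambda>h. \<bar>h\<bar> powr (\<gamma> - 2) * h) \<longlongrightarrow> \<bar>0\<bar> powr (\<gamma> - 2) * 0) (at (0::real))"
      using \<gamma> by (intro tendsto_intros) auto
    then have lim: "((\<lambda>h. \<bar>h\<bar> powr (\<gamma> - 2) * h) \<longlongrightarrow> \<gamma> * \<bar>0\<bar> powr (\<gamma> - 2) * 0) (at (0::real))"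
      by simp
    have "\<bar>h\<bar> powr (\<gamma> - 2) * h = (\<bar>h\<bar> powr \<gamma> - \<bar>0\<bar> powr \<gamma>) / (h - 0)" if "h \<noteq> 0" for h :: real
    proof -
      have "\<bar>h\<bar> powr \<gamma> = \<bar>h\<bar> powr (\<gamma> - 2) * h^2"
        using that powr_add[of "\<bar>h\<bar>" "\<gamma> - 2" 2] by simp
      then show ?thesis using that by (simp add: power2_eq_square)
    qed
    then have "eventually (\<lambda>h. \<bar>h\<bar> powr (\<gamma> - 2) * h = (\<bar>h\<bar> powr \<gamma> - \<bar>0\<bar> powr \<gamma>) / (h - 0)) (at (0::real))"
      by (simp add: eventually_at_filter)
    then show ?thesis unfolding 2 has_field_derivative_iff by (rule Lim_transform_eventually[OF lim])
  qed
qed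

lemma powr_half_power2:
  assumes "0 \<le> x" "0 < n"
  shows "(x powr (real n / 2))\<^sup>2 = x ^ n"
  using assms by (cases "x = 0") (auto simp: powr_power powr_realpow)

text \<open>Write \<open>U = |u - c|\<close>, \<open>s = n/(n-2)\<close>, \<open>P = U\<^sup>s\<close> and \<open>W = U/r + 4|\<nabla>u|\<close>. Then \<open>P\<^sup>2\<close> is \<open>U\<close> to the
  critical power, and \<open>v = U\<^bsup>s+1\<^esup>\<close> satisfies \<open>v\<^sup>n = (P\<^sup>2)\<^bsup>n-1\<^esup>\<close>, so the Gagliardo-Nirenberg inequality
  reads \<open>X\<^bsup>n-1\<^esup> \<le> (\<integral>P W)\<^sup>n\<close> with \<open>X = \<integral>P\<^sup>2\<close>. By Cauchy-Schwarz \<open>(\<integral>P W)\<^sup>2 \<le> X Z\<close> with \<open>Z = \<integral>W\<^sup>2\<close>, and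
  division by the finite number \<open>X\<^sup>n\<close> leaves \<open>X\<^bsup>n-2\<^esup> \<le> Z\<^sup>n\<close>. Finally
  \<open>(g U\<^sup>2)\<^sup>n = (g\<^bsup>n/2\<^esup>)\<^sup>2 (P\<^sup>2)\<^bsup>n-2\<^esup>\<close> is a product of \<open>n\<close> factors, to which Hoelder's inequality applies.\<close>

lemma sobolev_weighted_cube:
  fixes u g :: "'a::euclidean_space \<Rightarrow> real" and A c :: real
  defines "n \<equiv> DIM('a)"
  assumes n: "3 \<le> n" and r: "0 < r" and K: "K = cbox a (a + r *\<^sub>R One)"
    and u: "\<And>x. x \<in> K \<Longrightarrow> (u has_derivative (\<lambda>h. Du x \<bullet> h)) (at x within K)"
    and Du: "continuous_on K Du"
    and g[measurable]: "g \<in> borel_measurable borel" and g0: "\<And>x. 0 \<le> g x"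
    and A: "0 \<le> A" "(\<integral>\<^sup>+y\<in>K. ennreal (g y powr (n / 2)) \<partial>lborel) \<le> ennreal (A powr (n / 2))"
  shows "(\<integral>\<^sup>+y\<in>K. ennreal (g y * (u y - c)\<^sup>2) \<partial>lborel)
     \<le> ennreal A * (\<integral>\<^sup>+y\<in>K. ennreal ((\<bar>u y - c\<bar> / r + 4 * norm (Du y))\<^sup>2) \<partial>lborel)"
proof -
  define s where "s = n / (n - 2)"
  define U where "U y = \<bar>u y - c\<bar>" for y
  define P where "P y = U y powr s" for y
  define W where "W y = U y / r + 4 * norm (Du y)" for y
  define X where "X = (\<integral>\<^sup>+y\<in>K. ennreal ((P y)\<^sup>2) \<partial>lborel)"
  define Z where "Z = (\<integral>\<^sup>+y\<in>K. ennreal ((W y)\<^sup>2) \<partial>lborel)"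
  have n2: "real (n - 2) = real n - 2" "real (n - 1) = real n - 1" using n by auto
  \<comment> \<open>The bound by 3 makes the factor \<open>s + 1\<close> from the chain rule at most 4, whatever the dimension.\<close>
  have s1: "1 < s" "s \<le> 3" using n by (auto simp: s_def n2 field_simps)
  have [measurable]: "K \<in> sets borel" "compact K" by (auto simp: K)
  have cu: "continuous_on K u"
    using u by (meson has_derivative_continuous continuous_on_eq_continuous_within)
  have cU: "continuous_on K U" unfolding U_def by (intro continuous_intros cu)
  have U0: "0 \<le> U y" for y by (simp add: U_def)
  have cP: "continuous_on K P" unfolding P_def
    using s1 U0 by (intro continuous_on_powr' cU continuous_intros) auto
  have cW: "continuous_on K W" unfolding W_def
    using r by (intro continuous_intros cU Du) auto
  have P0: "0 \<le> P y" for y by (simp add: P_def)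
  have W0: "0 \<le> W y" for y using r U0 by (simp add: W_def)
  note meas = borel_indicator_continuous[OF _ \<open>K \<in> sets borel\<close>]
  define v where "v y = U y powr (s + 1)" for y
  define Dv where "Dv y = ((s + 1) * \<bar>u y - c\<bar> powr (s + 1 - 2) * (u y - c)) *\<^sub>R Du y" for y
  have dv: "(v has_derivative (\<lambda>h. Dv y \<bullet> h)) (at y within K)" if y: "y \<in> K" for y
  proof -
    have "((\<lambda>y. u y - c) has_derivative (\<lambda>h. Du y \<bullet> h)) (at y within K)"
      using u[OF y] by (auto intro!: derivative_eq_intros)
    then have "((\<lambda>y. \<bar>u y - c\<bar> powr (s+1)) has_derivative
       (\<lambda>h. (Du y \<bullet> h) * ((s + 1) * \<bar>u y - c\<bar> powr (s + 1 - 2) * (u y - c)))) (at y within K)"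
      using has_real_derivative_abs_powr[of "s+1" "u y - c"] s1
      by (intro DERIV_compose_FDERIV[where f="\<lambda>s. \<bar>s\<bar> powr _" and g="\<lambda>y. u y - c"]) auto
    then show ?thesis by (simp add: v_def[abs_def] U_def Dv_def mult_ac)
  qed
  have cDv: "continuous_on K Dv" unfolding Dv_def
    using s1 by (intro continuous_intros continuous_on_powr' cu Du) auto
  have vW: "v y / r + norm (Dv y) \<le> P y * W y" for y
  proof -
    have a: "v y = P y * U y" using U0[of y] by (simp add: v_def P_def powr_add)
    have b: "\<bar>u y - c\<bar> powr (s + 1 - 2) * \<bar>u y - c\<bar> = P y"
      using powr_add[of "\<bar>u y - c\<bar>" "s - 1" 1] by (simp add: P_def U_def)
    have "norm (Dv y) = (s + 1) * (\<bar>u y - c\<bar> powr (s + 1 - 2) * \<bar>u y - c\<bar>) * norm (Du y)"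
      using s1 by (simp add: Dv_def abs_mult)
    also have "\<dots> \<le> 4 * P y * norm (Du y)"
      unfolding b using s1 P0[of y] by (intro mult_right_mono) auto
    finally show ?thesis by (simp add: a W_def algebra_simps)
  qed
  have X1: "X ^ (n - 1) \<le> (\<integral>\<^sup>+y\<in>K. ennreal (P y * W y) \<partial>lborel) ^ n"
  proof -
    have "X = (\<integral>\<^sup>+y\<in>K. (ennreal ((P y)\<^sup>2) * indicator K y) \<partial>lborel)"
      unfolding X_def by (intro nn_integral_cong) (auto simp: indicator_def)
    also have "\<dots> ^ (n - 1) \<le> (\<integral>\<^sup>+y\<in>K. ennreal (v y / r + norm (Dv y)) \<partial>lborel) ^ n"
      unfolding n_def
    proof (rule gagliardo_nirenberg_cube[OF _ r K dv cDv])
      fix y assume y: "y \<in> K"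
      have "((P y)\<^sup>2) ^ (n - 1) = v y ^ n"
      proof (cases "U y = 0")
        case False
        have "s * (2 * real (n - 1)) = (s + 1) * n" using n by (simp add: s_def n2 field_simps)
        then show ?thesis using False
          by (simp add: P_def v_def powr_power power_mult[symmetric] mult_ac)
      qed (use n in \<open>simp add: P_def v_def zero_power\<close>)
      then show "(ennreal ((P y)\<^sup>2) * indicator K y) ^ (DIM('a) - 1) \<le> ennreal (v y) ^ DIM('a)"
        using y by (simp add: ennreal_power v_def n_def)
    qed (use n in \<open>auto simp: v_def n_def intro!: meas continuous_intros cP\<close>)
    also have "\<dots> \<le> (\<integral>\<^sup>+y\<in>K. ennreal (P y * W y) \<partial>lborel) ^ n"
      by (intro power_mono nn_integral_mono mult_right_mono ennreal_leI vW) auto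
    finally show ?thesis .
  qed
  have XZ: "(\<integral>\<^sup>+y\<in>K. ennreal (P y * W y) \<partial>lborel)\<^sup>2 \<le> X * Z"
  proof -
    \<comment> \<open>Cauchy-Schwarz is Hoelder with two factors, indexed by the booleans.\<close>
    let ?f = "\<lambda>b y. ennreal ((if b then P y else W y)\<^sup>2) * indicator K y"
    have "(\<integral>\<^sup>+y\<in>K. ennreal (P y * W y) \<partial>lborel) ^ card (UNIV :: bool set)
      \<le> 1 * (\<Prod>b\<in>UNIV. \<integral>\<^sup>+y. ?f b y \<partial>lborel)"
    proof (rule hoelder_power)
      show "?f b \<in> borel_measurable lborel" for b
        by (cases b) (auto intro!: meas continuous_intros cP cW)
      show "(\<lambda>y. ennreal (P y * W y) * indicator K y) \<in> borel_measurable lborel"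
        using meas[of "\<lambda>y. P y * W y"] by (auto intro!: continuous_intros cP cW)
      show "(ennreal (P y * W y) * indicator K y) ^ card (UNIV :: bool set) \<le> 1 * (\<Prod>b\<in>UNIV. ?f b y)" for y
        using P0[of y] W0[of y]
        by (simp add: UNIV_bool indicator_def ennreal_power ennreal_mult[symmetric] power2_eq_square mult_ac)
    qed auto
    then show ?thesis by (simp add: UNIV_bool X_def Z_def mult.commute power2_eq_square)
  qed
  have Xfin: "X < \<infinity>"
  proof -
    have "continuous_on K (\<lambda>y. (P y)\<^sup>2)" by (intro continuous_intros cP)
    then have "bounded ((\<lambda>y. (P y)\<^sup>2) ` K)"
      using \<open>compact K\<close> by (intro compact_imp_bounded compact_continuous_image)
    then obtain b where b: "\<And>y. y \<in> K \<Longrightarrow> (P y)\<^sup>2 \<le> b" by (force simp: bounded_real)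
    have "X \<le> (\<integral>\<^sup>+y. ennreal b * indicator K y \<partial>lborel)"
      unfolding X_def by (intro nn_integral_mono) (auto simp: indicator_def intro!: ennreal_leI b)
    also have "\<dots> = ennreal b * emeasure lborel K" by (simp add: nn_integral_cmult_indicator)
    also have "\<dots> < \<infinity>" using emeasure_lborel_cbox_finite[of a "a + r *\<^sub>R One"] by (simp add: K ennreal_mult_less_top)
    finally show ?thesis .
  qed
  have XZn: "X ^ (n - 2) \<le> Z ^ n"
  proof (cases "X = 0")
    case True
    then show ?thesis using n by (simp add: zero_power)
  next
    case False
    have "X ^ n * X ^ (n - 2) = (X ^ (n - 1))\<^sup>2"
    proof -
      have "n + (n - 2) = (n - 1) * 2" using n by simp
      then show ?thesis by (metis power_add power_mult)
    qed
    also have "\<dots> \<le> ((\<integral>\<^sup>+y\<in>K. ennreal (P y * W y) \<partial>lborel) ^ n)\<^sup>2"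
      by (intro power_mono X1) auto
    also have "\<dots> = ((\<integral>\<^sup>+y\<in>K. ennreal (P y * W y) \<partial>lborel)\<^sup>2) ^ n"
      by (simp add: power_mult[symmetric] mult.commute)
    also have "\<dots> \<le> (X * Z) ^ n" by (intro power_mono XZ) auto
    also have "\<dots> = X ^ n * Z ^ n" by (simp add: power_mult_distrib)
    finally show ?thesis using False Xfin
      by (subst (asm) ennreal_mult_le_mult_iff) (auto simp: power_eq_top_ennreal)
  qed
  let ?B = "\<integral>\<^sup>+y\<in>K. ennreal (g y powr (n / 2)) \<partial>lborel"
  have "(\<integral>\<^sup>+y\<in>K. ennreal (g y * (U y)\<^sup>2) \<partial>lborel) ^ n \<le> ?B\<^sup>2 * X ^ (n - 2)"
  proof -
    let ?f = "\<lambda>j y. (if j < 2 then ennreal (g y powr (n / 2)) * indicator K y else ennreal ((P y)\<^sup>2) * indicator K y)"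
    have split: "(\<Prod>j<n. if j < 2 then p else q) = p\<^sup>2 * q ^ (n - 2)" for p q :: ennreal
    proof -
      have "{..<n} \<inter> {j. j < 2} = {..<2}" "{..<n} \<inter> - {j. j < 2} = {2..<n}" using n by auto
      then show ?thesis by (simp add: prod.If_cases)
    qed
    have mU: "(\<lambda>y. ennreal ((U y)\<^sup>2) * indicator K y) \<in> borel_measurable lborel"
      by (auto intro!: meas continuous_intros cU)
    have mP: "(\<lambda>y. ennreal ((P y)\<^sup>2) * indicator K y) \<in> borel_measurable lborel"
      by (auto intro!: meas continuous_intros cP)
    have "(\<lambda>y. ennreal (g y) * (ennreal ((U y)\<^sup>2) * indicator K y)) \<in> borel_measurable lborel"
      using mU by measurable
    then have mg: "(\<lambda>y. ennreal (g y * (U y)\<^sup>2) * indicator K y) \<in> borel_measurable lborel"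
      using g0 by (simp add: ennreal_mult mult.assoc)
    have "(\<integral>\<^sup>+y\<in>K. ennreal (g y * (U y)\<^sup>2) \<partial>lborel) ^ card {..<n}
       \<le> 1 * (\<Prod>j\<in>{..<n}. \<integral>\<^sup>+y. ?f j y \<partial>lborel)"
    proof (rule hoelder_power[OF _ _ mg])
      fix y
      have "(g y * (U y)\<^sup>2) ^ n = (g y powr (n / 2))\<^sup>2 * ((P y)\<^sup>2) ^ (n - 2)"
      proof -
        have "((P y)\<^sup>2) ^ (n - 2) = U y ^ (2 * n)"
        proof (cases "U y = 0")
          case False
          have e: "s * real (2 * (n - 2)) = real (2 * n)" using n by (simp add: s_def n2 field_simps)
          have "((P y)\<^sup>2) ^ (n - 2) = U y powr (s * real (2 * (n - 2)))"
            using False U0[of y] unfolding P_def power_mult[symmetric] by (simp add: powr_power mult_ac)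
          then show ?thesis unfolding e using False U0[of y] by (subst (asm) powr_realpow) auto
        qed (use n in \<open>simp add: P_def zero_power\<close>)
        then show ?thesis using g0[of y] n by (simp add: powr_half_power2 power_mult_distrib power_mult[symmetric])
      qed
      then have "ennreal (g y * (U y)\<^sup>2) ^ n = (ennreal (g y powr (n / 2)))\<^sup>2 * ennreal ((P y)\<^sup>2) ^ (n - 2)"
        using g0[of y] by (simp add: ennreal_power ennreal_mult[symmetric])
      then show "(ennreal (g y * (U y)\<^sup>2) * indicator K y) ^ card {..<n} \<le> 1 * (\<Prod>j\<in>{..<n}. ?f j y)"
        using n by (simp add: split) (auto simp: indicator_def zero_power)
    next
      show "?f j \<in> borel_measurable lborel" for j
        using mP by (cases "j < 2") auto
    qed (use n in \<open>auto simp: lessThan_empty_iff\<close>)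
    also have "(\<Prod>j\<in>{..<n}. \<integral>\<^sup>+y. ?f j y \<partial>lborel) = (\<Prod>j<n. if j < 2 then ?B else X)"
      by (intro prod.cong) (auto simp: X_def)
    finally show ?thesis by (simp add: split)
  qed
  also have "\<dots> \<le> (ennreal (A powr (n / 2)))\<^sup>2 * Z ^ n"
    by (intro mult_mono power_mono XZn A) auto
  also have "\<dots> = (ennreal A * Z) ^ n"
    using A n by (simp add: ennreal_power powr_half_power2 power_mult_distrib)
  finally have "(\<integral>\<^sup>+y\<in>K. ennreal (g y * (U y)\<^sup>2) \<partial>lborel) \<le> ennreal A * Z"
    by (rule ennreal_power_le_cancel) (use n in auto)
  then show ?thesis by (simp add: U_def Z_def W_def)
qed

section \<open>The Poincare inequality as a double integral\<close>

text \<open>Expanding the nonnegative integral of \<open>(f' - m)\<^sup>2\<close>, where \<open>m\<close> is the increment and hence the mean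
  of \<open>f'\<close>, gives Jensen's inequality.\<close>

lemma square_increment_le:
  fixes f f' :: "real \<Rightarrow> real"
  assumes f: "\<And>t. t \<in> {0..1} \<Longrightarrow> (f has_real_derivative f' t) (at t within {0..1})"
    and f': "continuous_on {0..1} f'"
  shows "ennreal ((f 1 - f 0)\<^sup>2) \<le> (\<integral>\<^sup>+t\<in>{0..1}. ennreal ((f' t)\<^sup>2) \<partial>lborel)"
proof -
  define m where "m = f 1 - f 0"
  define I where "I = integral {0..1} (\<lambda>t. (f' t)\<^sup>2)"
  have 1: "(f' has_integral m) {0..1}"
    unfolding m_def using f by (intro fundamental_theorem_of_calculus)
      (auto simp: has_real_derivative_iff_has_vector_derivative[symmetric])
  have 2: "((\<lambda>t. (f' t)\<^sup>2) has_integral I) {0..1}"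
    unfolding I_def by (intro integrable_integral integrable_continuous_real continuous_intros f')
  have "((\<lambda>t. (f' t)\<^sup>2 - (2 * m) * f' t + m\<^sup>2) has_integral I - (2 * m) * m + m\<^sup>2 * (1 - 0)) {0..1::real}"
    using has_integral_const_real[of "m\<^sup>2" 0 1]
    by (intro has_integral_add has_integral_diff has_integral_mult_right 1 2) simp
  moreover have "(f' t)\<^sup>2 - (2 * m) * f' t + m\<^sup>2 = (f' t - m)\<^sup>2" for t
    by (simp add: power2_diff)
  ultimately have "((\<lambda>t. (f' t - m)\<^sup>2) has_integral I - (2 * m) * m + m\<^sup>2 * (1 - 0)) {0..1::real}"
    by simp
  from has_integral_nonneg[OF this] have "0 \<le> I - (2 * m) * m + m\<^sup>2 * (1 - 0)" by simp
  then have "m\<^sup>2 \<le> I" by (simp add: power2_eq_square)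
  moreover have "(\<integral>\<^sup>+t\<in>{0..1}. ennreal ((f' t)\<^sup>2) \<partial>lborel) = ennreal I"
    by (intro nn_integral_has_integral_lebesgue' 2) auto
  ultimately show ?thesis by (simp add: m_def ennreal_leI)
qed

lemma nn_integral_affine_le:
  fixes D :: "'a::euclidean_space \<Rightarrow> ennreal"
  assumes [measurable]: "D \<in> borel_measurable borel" and c: "1 / 2 \<le> c"
  shows "(\<integral>\<^sup>+x. D (t + c *\<^sub>R x) \<partial>lborel) \<le> 2 ^ DIM('a) * (\<integral>\<^sup>+x. D x \<partial>lborel)"
proof -
  have "(\<integral>\<^sup>+x. D x \<partial>lborel)
     = integral\<^sup>N (density (distr lborel borel (\<lambda>x. t + c *\<^sub>R x)) (\<lambda>_. \<bar>c\<bar>^DIM('a))) D"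
    using c by (subst lborel_affine[of c t]) auto
  also have "\<dots> = ennreal (\<bar>c\<bar> ^ DIM('a)) * (\<integral>\<^sup>+x. D (t + c *\<^sub>R x) \<partial>lborel)"
    by (subst nn_integral_density) (auto simp: nn_integral_distr nn_integral_cmult)
  finally have eq: "(\<integral>\<^sup>+x. D x \<partial>lborel) = ennreal (\<bar>c\<bar> ^ DIM('a)) * (\<integral>\<^sup>+x. D (t + c *\<^sub>R x) \<partial>lborel)" .
  have "1 \<le> (2 * c) ^ DIM('a)" using c by (intro one_le_power) simp
  then have "ennreal 1 \<le> ennreal (2 ^ DIM('a)) * ennreal (\<bar>c\<bar> ^ DIM('a))"
    using c by (subst ennreal_mult[symmetric]) (auto simp: power_mult_distrib intro!: ennreal_leI)
  then have "1 * (\<integral>\<^sup>+x. D (t + c *\<^sub>R x) \<partial>lborel)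
     \<le> (ennreal (2 ^ DIM('a)) * ennreal (\<bar>c\<bar> ^ DIM('a))) * (\<integral>\<^sup>+x. D (t + c *\<^sub>R x) \<partial>lborel)"
    by (intro mult_right_mono) auto
  also have "\<dots> = 2 ^ DIM('a) * (\<integral>\<^sup>+x. D x \<partial>lborel)"
    by (simp add: eq mult.assoc ennreal_power[symmetric])
  finally show ?thesis by simp
qed

lemma dist_cube_le:
  fixes x y :: "'a::euclidean_space" and r :: real
  assumes "x \<in> cbox a (a + r *\<^sub>R One)" "y \<in> cbox a (a + r *\<^sub>R One)"
  shows "norm (x - y) \<le> DIM('a) * r"
proof -
  have "norm (x - y) \<le> (\<Sum>b\<in>Basis. \<bar>(x - y) \<bullet> b\<bar>)" by (rule norm_le_l1)
  also have "\<dots> \<le> (\<Sum>b\<in>(Basis::'a set). r)"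
    using assms by (intro sum_mono) (force simp: mem_cube inner_diff_left abs_le_iff)
  finally show ?thesis by simp
qed

text \<open>Along the segment from \<open>y\<close> to \<open>x\<close> the squared increment is at most \<open>|x - y|\<^sup>2\<close> times the integral
  of \<open>|\<nabla>u|\<^sup>2\<close> at the points \<open>t x + (1 - t) y\<close>. For each \<open>t\<close> one of the coefficients \<open>t\<close> and \<open>1 - t\<close> is
  at least \<open>1/2\<close>; integrating first in the variable that carries it costs at most the Jacobian
  factor \<open>2\<^sup>n\<close>, and the other variable contributes \<open>|K|\<close>.\<close>

lemma poincare_double_cube:
  fixes u :: "'a::euclidean_space \<Rightarrow> real" and r :: real
  defines "n \<equiv> DIM('a)"
  assumes r: "0 < r" and K: "K = cbox a (a + r *\<^sub>R One)"
    and u: "\<And>x. x \<in> K \<Longrightarrow> (u has_derivative (\<lambda>h. Du x \<bullet> h)) (at x within K)"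
    and Du: "continuous_on K Du"
  shows "(\<integral>\<^sup>+x\<in>K. (\<integral>\<^sup>+y\<in>K. ennreal ((u x - u y)\<^sup>2) \<partial>lborel) \<partial>lborel)
     \<le> ennreal ((n * r)\<^sup>2 * 2 ^ n) * emeasure lborel K * (\<integral>\<^sup>+y\<in>K. ennreal ((norm (Du y))\<^sup>2) \<partial>lborel)"
proof -
  define D where "D z = ennreal ((norm (Du z))\<^sup>2) * indicator K z" for z
  define R where "R = (n * r)\<^sup>2"
  have [measurable]: "K \<in> sets borel" by (simp add: K)
  have D[measurable]: "D \<in> borel_measurable borel"
    unfolding D_def by (intro borel_indicator_continuous continuous_intros Du) measurable
  have pt: "ennreal ((u x - u y)\<^sup>2) \<le> ennreal R * (\<integral>\<^sup>+t\<in>{0..1}. D (y + t *\<^sub>R (x - y)) \<partial>lborel)"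
    if x: "x \<in> K" and y: "y \<in> K" for x y
  proof -
    define L where "L t = y + t *\<^sub>R (x - y)" for t :: real
    have LK: "L t \<in> K" if "t \<in> {0..1}" for t
    proof -
      have "L t = (1 - t) *\<^sub>R y + t *\<^sub>R x" by (simp add: L_def algebra_simps)
      moreover have "convex K" by (simp add: K)
      ultimately show ?thesis using x y that convexD_alt[of K y x t] by auto
    qed
    have cL: "continuous_on {0..1} L" unfolding L_def by (intro continuous_intros)
    have "ennreal ((u (L 1) - u (L 0))\<^sup>2) \<le> (\<integral>\<^sup>+t\<in>{0..1}. ennreal ((Du (L t) \<bullet> (x - y))\<^sup>2) \<partial>lborel)"
    proof (rule square_increment_le)
      fix t :: real assume t: "t \<in> {0..1}"
      have "(L has_derivative (\<lambda>h. h *\<^sub>R (x - y))) (at t within {0..1})"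
        unfolding L_def by (auto intro!: derivative_eq_intros)
      moreover have "(u has_derivative (\<lambda>h. Du (L t) \<bullet> h)) (at (L t) within L ` {0..1})"
        by (rule has_derivative_subset[OF u]) (use LK t in auto)
      ultimately have "((\<lambda>t. u (L t)) has_derivative (\<lambda>h. Du (L t) \<bullet> (h *\<^sub>R (x - y)))) (at t within {0..1})"
        by (rule has_derivative_in_compose)
      then show "((\<lambda>t. u (L t)) has_real_derivative (Du (L t) \<bullet> (x - y))) (at t within {0..1})"
        by (simp add: has_field_derivative_def mult_commute_abs)
    next
      show "continuous_on {0..1} (\<lambda>t. Du (L t) \<bullet> (x - y))"
        by (intro continuous_intros continuous_on_compose2[OF Du cL]) (use LK in auto)
    qed
    also have "\<dots> \<le> (\<integral>\<^sup>+t. ennreal R * (D (L t) * indicator {0..1} t) \<partial>lborel)"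
    proof (intro nn_integral_mono)
      fix t :: real
      have "(Du z \<bullet> (x - y))\<^sup>2 \<le> R * (norm (Du z))\<^sup>2" for z
      proof -
        have "\<bar>Du z \<bullet> (x - y)\<bar> \<le> norm (Du z) * norm (x - y)" by (rule Cauchy_Schwarz_ineq2)
        also have "\<dots> \<le> norm (Du z) * (n * r)"
          using dist_cube_le[of x a r y] x y by (intro mult_left_mono) (auto simp: K n_def)
        finally have "\<bar>Du z \<bullet> (x - y)\<bar>\<^sup>2 \<le> (norm (Du z) * (n * r))\<^sup>2" by (intro power_mono) auto
        then show ?thesis by (simp add: R_def power_mult_distrib mult_ac)
      qed
      then show "ennreal ((Du (L t) \<bullet> (x - y))\<^sup>2) * indicator {0..1} t \<le> ennreal R * (D (L t) * indicator {0..1} t)"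
        using LK[of t] by (auto simp: D_def indicator_def R_def ennreal_mult[symmetric] intro!: ennreal_leI)
    qed
    also have "\<dots> = ennreal R * (\<integral>\<^sup>+t\<in>{0..1}. D (L t) \<partial>lborel)"
      by (rule nn_integral_cmult) (simp add: L_def)
    finally show ?thesis by (simp add: L_def)
  qed
  define H where "H t x y = D (y + t *\<^sub>R (x - y)) * indicator {0..1} t * indicator K x * indicator K y" for t :: real and x y
  have mH[measurable (raw)]: "(\<lambda>x. H (a x) (b x) (c x)) \<in> borel_measurable M"
    if [measurable]: "a \<in> borel_measurable M" "b \<in> borel_measurable M" "c \<in> borel_measurable M" for a b c M
    unfolding H_def by measurable
  define J where "J = (\<integral>\<^sup>+y. D y \<partial>lborel)"
  have ps: "pair_sigma_finite (lborel :: 'b::euclidean_space measure) (lborel :: 'c::euclidean_space measure)"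
    by unfold_locales
  have slice: "(\<integral>\<^sup>+x. \<integral>\<^sup>+y. H t x y \<partial>lborel \<partial>lborel) \<le> 2 ^ n * J * emeasure lborel K * indicator {0..1} t" for t
  proof (cases "t \<in> {0..1}")
    case t: True
    show ?thesis
    proof (cases "t \<le> 1 / 2")
      case True
      have "(\<integral>\<^sup>+y. H t x y \<partial>lborel) \<le> 2 ^ n * J * indicator K x" for x
      proof (cases "x \<in> K")
        case x: True
        have "(\<integral>\<^sup>+y. H t x y \<partial>lborel) \<le> (\<integral>\<^sup>+y. D (t *\<^sub>R x + (1 - t) *\<^sub>R y) \<partial>lborel)"
          using t x by (intro nn_integral_mono) (auto simp: H_def indicator_def algebra_simps)
        also have "\<dots> \<le> 2 ^ n * J" unfolding n_def J_def
          using True by (intro nn_integral_affine_le) auto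
        finally show ?thesis using x by simp
      qed (simp add: H_def)
      then have "(\<integral>\<^sup>+x. \<integral>\<^sup>+y. H t x y \<partial>lborel \<partial>lborel) \<le> (\<integral>\<^sup>+x. 2 ^ n * J * indicator K x \<partial>lborel)"
        by (intro nn_integral_mono)
      then show ?thesis using t by (simp add: nn_integral_cmult_indicator)
    next
      case False
      have "(\<integral>\<^sup>+x. H t x y \<partial>lborel) \<le> 2 ^ n * J * indicator K y" for y
      proof (cases "y \<in> K")
        case y: True
        have "(\<integral>\<^sup>+x. H t x y \<partial>lborel) \<le> (\<integral>\<^sup>+x. D ((1 - t) *\<^sub>R y + t *\<^sub>R x) \<partial>lborel)"
          using t y by (intro nn_integral_mono) (auto simp: H_def indicator_def algebra_simps)
        also have "\<dots> \<le> 2 ^ n * J" unfolding n_def J_def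
          using False by (intro nn_integral_affine_le) auto
        finally show ?thesis using y by simp
      qed (simp add: H_def)
      then have "(\<integral>\<^sup>+y. \<integral>\<^sup>+x. H t x y \<partial>lborel \<partial>lborel) \<le> (\<integral>\<^sup>+y. 2 ^ n * J * indicator K y \<partial>lborel)"
        by (intro nn_integral_mono)
      moreover have "(\<integral>\<^sup>+x. \<integral>\<^sup>+y. H t x y \<partial>lborel \<partial>lborel) = (\<integral>\<^sup>+y. \<integral>\<^sup>+x. H t x y \<partial>lborel \<partial>lborel)"
        by (rule pair_sigma_finite.Fubini'[OF ps]) measurable
      ultimately show ?thesis using t by (simp add: nn_integral_cmult_indicator)
    qed
  qed (simp add: H_def)
  have "(\<integral>\<^sup>+x\<in>K. (\<integral>\<^sup>+y\<in>K. ennreal ((u x - u y)\<^sup>2) \<partial>lborel) \<partial>lborel)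
      \<le> (\<integral>\<^sup>+x. \<integral>\<^sup>+y. ennreal R * (\<integral>\<^sup>+t. H t x y \<partial>lborel) \<partial>lborel \<partial>lborel)"
  proof (intro nn_integral_mono)
    fix x :: 'a
    show "(\<integral>\<^sup>+y\<in>K. ennreal ((u x - u y)\<^sup>2) \<partial>lborel) * indicator K x \<le> (\<integral>\<^sup>+y. ennreal R * (\<integral>\<^sup>+t. H t x y \<partial>lborel) \<partial>lborel)"
    proof (cases "x \<in> K")
      case True
      then show ?thesis using pt[OF True] by (auto intro!: nn_integral_mono simp: H_def indicator_def)
    qed simp
  qed
  also have "\<dots> = ennreal R * (\<integral>\<^sup>+x. \<integral>\<^sup>+y. \<integral>\<^sup>+t. H t x y \<partial>lborel \<partial>lborel \<partial>lborel)"
  proof -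
    have "(\<integral>\<^sup>+y. ennreal R * (\<integral>\<^sup>+t. H t x y \<partial>lborel) \<partial>lborel)
        = ennreal R * (\<integral>\<^sup>+y. \<integral>\<^sup>+t. H t x y \<partial>lborel \<partial>lborel)" for x
      by (rule nn_integral_cmult) measurable
    moreover have "(\<integral>\<^sup>+x. ennreal R * (\<integral>\<^sup>+y. \<integral>\<^sup>+t. H t x y \<partial>lborel \<partial>lborel) \<partial>lborel)
        = ennreal R * (\<integral>\<^sup>+x. \<integral>\<^sup>+y. \<integral>\<^sup>+t. H t x y \<partial>lborel \<partial>lborel \<partial>lborel)"
      by (rule nn_integral_cmult) measurable
    ultimately show ?thesis by simp
  qed
  also have "(\<integral>\<^sup>+x. \<integral>\<^sup>+y. \<integral>\<^sup>+t. H t x y \<partial>lborel \<partial>lborel \<partial>lborel) = (\<integral>\<^sup>+x. \<integral>\<^sup>+t. \<integral>\<^sup>+y. H t x y \<partial>lborel \<partial>lborel \<partial>lborel)"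
    by (intro nn_integral_cong pair_sigma_finite.Fubini'[OF ps]) measurable
  also have "\<dots> = (\<integral>\<^sup>+t. \<integral>\<^sup>+x. \<integral>\<^sup>+y. H t x y \<partial>lborel \<partial>lborel \<partial>lborel)"
    by (intro pair_sigma_finite.Fubini'[OF ps]) measurable
  also have "\<dots> \<le> (\<integral>\<^sup>+t. 2 ^ n * J * emeasure lborel K * indicator {0..1::real} t \<partial>lborel)"
    by (intro nn_integral_mono slice)
  also have "\<dots> = 2 ^ n * J * emeasure lborel K"
    by (simp add: nn_integral_cmult_indicator)
  also have "ennreal R * \<dots> = ennreal (R * 2 ^ n) * emeasure lborel K * J"
    by (simp add: ennreal_mult R_def ennreal_power[symmetric] mult_ac)
  finally show ?thesis unfolding R_def J_def D_def by (simp add: mult_left_mono)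
qed

section \<open>The weighted inequality for scalar functions\<close>

definition poincare_constant :: "nat \<Rightarrow> real" where
  "poincare_constant n = 2 * (real n)\<^sup>2 * 2 ^ n + 32"

text \<open>Apply the weighted Sobolev inequality in \<open>y\<close> with \<open>c = u(x)\<close>, use
  \<open>(|u(y) - u(x)|/r + 4|\<nabla>u|)\<^sup>2 \<le> (2/r\<^sup>2) (u(x) - u(y))\<^sup>2 + 32 |\<nabla>u|\<^sup>2\<close>, and integrate in \<open>x\<close>. The factor
  \<open>r\<^sup>2\<close> of the Poincare inequality cancels the \<open>r\<^bsup>-2\<^esup>\<close>; this is where the value of
  \<open>poincare_constant\<close> comes from.\<close>

lemma weighted_poincare_closed_cube:
  fixes u g :: "'a::euclidean_space \<Rightarrow> real" and A r :: real
  defines "n \<equiv> DIM('a)"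
  assumes n: "3 \<le> n" and r: "0 < r" and K: "K = cbox a (a + r *\<^sub>R One)"
    and u: "\<And>x. x \<in> K \<Longrightarrow> (u has_derivative (\<lambda>h. Du x \<bullet> h)) (at x within K)"
    and Du: "continuous_on K Du"
    and g[measurable]: "g \<in> borel_measurable borel" and g0: "\<And>x. 0 \<le> g x"
    and A: "0 \<le> A" "(\<integral>\<^sup>+y\<in>K. ennreal (g y powr (n / 2)) \<partial>lborel) \<le> ennreal (A powr (n / 2))"
  shows "(\<integral>\<^sup>+x\<in>K. (\<integral>\<^sup>+y\<in>K. ennreal (g y * (u x - u y)\<^sup>2) \<partial>lborel) \<partial>lborel)
     \<le> ennreal (poincare_constant n * A) * emeasure lborel K
        * (\<integral>\<^sup>+y\<in>K. ennreal ((norm (Du y))\<^sup>2) \<partial>lborel)"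
proof -
  define J where "J = (\<integral>\<^sup>+y\<in>K. ennreal ((norm (Du y))\<^sup>2) \<partial>lborel)"
  define I where "I x = (\<integral>\<^sup>+y\<in>K. ennreal ((u x - u y)\<^sup>2) \<partial>lborel)" for x
  have [measurable]: "K \<in> sets borel" by (simp add: K)
  have cu: "continuous_on K u"
    using u by (meson has_derivative_continuous continuous_on_eq_continuous_within)
  define w where "w x = indicator K x *\<^sub>R u x" for x
  have [measurable]: "w \<in> borel_measurable borel"
    unfolding w_def using cu by (intro borel_measurable_continuous_on_indicator) auto
  have "(\<lambda>x. (\<integral>\<^sup>+y. ennreal ((w x - w y)\<^sup>2) * indicator K y \<partial>lborel) * indicator K x) \<in> borel_measurable borel"
    by measurable
  also have "(\<lambda>x. (\<integral>\<^sup>+y. ennreal ((w x - w y)\<^sup>2) * indicator K y \<partial>lborel) * indicator K x) = (\<lambda>x. I x * indicator K x)"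
    unfolding I_def w_def by (intro ext) (auto simp: indicator_def intro!: nn_integral_cong)
  finally have mI: "(\<lambda>x. I x * indicator K x) \<in> borel_measurable borel" .
  have inner: "(\<integral>\<^sup>+y\<in>K. ennreal (g y * (u x - u y)\<^sup>2) \<partial>lborel) \<le> ennreal A * (ennreal (2 / r\<^sup>2) * I x + 32 * J)" for x
  proof -
    have "(\<integral>\<^sup>+y\<in>K. ennreal (g y * (u x - u y)\<^sup>2) \<partial>lborel) = (\<integral>\<^sup>+y\<in>K. ennreal (g y * (u y - u x)\<^sup>2) \<partial>lborel)"
      by (simp add: power2_commute)
    also have "\<dots> \<le> ennreal A * (\<integral>\<^sup>+y\<in>K. ennreal ((\<bar>u y - u x\<bar> / r + 4 * norm (Du y))\<^sup>2) \<partial>lborel)"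
      using sobolev_weighted_cube[OF n[unfolded n_def] r K u Du g g0 A(1) A(2)[unfolded n_def]] by simp
    also have "(\<integral>\<^sup>+y\<in>K. ennreal ((\<bar>u y - u x\<bar> / r + 4 * norm (Du y))\<^sup>2) \<partial>lborel)
       \<le> (\<integral>\<^sup>+y. ennreal (2 / r\<^sup>2) * (ennreal ((u x - u y)\<^sup>2) * indicator K y) + 32 * (ennreal ((norm (Du y))\<^sup>2) * indicator K y) \<partial>lborel)"
    proof (intro nn_integral_mono)
      fix y
      have "(\<bar>u y - u x\<bar> / r + 4 * norm (Du y))\<^sup>2 \<le> 2 * (\<bar>u y - u x\<bar> / r)\<^sup>2 + 2 * (4 * norm (Du y))\<^sup>2"
        using sum_squares_bound[of "\<bar>u y - u x\<bar> / r" "4 * norm (Du y)"] by (simp add: power2_sum)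
      also have "\<dots> = 2 / r\<^sup>2 * (u x - u y)\<^sup>2 + 32 * (norm (Du y))\<^sup>2"
        by (simp add: power_divide power_mult_distrib power2_commute)
      finally have "ennreal ((\<bar>u y - u x\<bar> / r + 4 * norm (Du y))\<^sup>2) \<le> ennreal (2 / r\<^sup>2 * (u x - u y)\<^sup>2 + 32 * (norm (Du y))\<^sup>2)"
        by (rule ennreal_leI)
      also have "\<dots> = ennreal (2 / r\<^sup>2) * ennreal ((u x - u y)\<^sup>2) + 32 * ennreal ((norm (Du y))\<^sup>2)"
        by (simp only: ennreal_plus[OF mult_nonneg_nonneg mult_nonneg_nonneg] ennreal_mult zero_le_power2
            divide_nonneg_nonneg zero_le_numeral ennreal_numeral)
      finally show "ennreal ((\<bar>u y - u x\<bar> / r + 4 * norm (Du y))\<^sup>2) * indicator K y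
         \<le> ennreal (2 / r\<^sup>2) * (ennreal ((u x - u y)\<^sup>2) * indicator K y) + 32 * (ennreal ((norm (Du y))\<^sup>2) * indicator K y)"
        by (auto simp: indicator_def)
    qed
    also have "\<dots> = ennreal (2 / r\<^sup>2) * I x + 32 * J"
    proof -
      have 1: "(\<lambda>y. ennreal ((u x - u y)\<^sup>2) * indicator K y) \<in> borel_measurable lborel"
        by (simp, intro borel_indicator_continuous continuous_intros cu) auto
      have 2: "(\<lambda>y. ennreal ((norm (Du y))\<^sup>2) * indicator K y) \<in> borel_measurable lborel"
        by (simp, intro borel_indicator_continuous continuous_intros Du) auto
      show ?thesis using 1 2 unfolding I_def J_def
        by (subst nn_integral_add) (auto simp: nn_integral_cmult)
    qed
    finally show ?thesis by (simp add: mult_left_mono)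
  qed
  have "(\<integral>\<^sup>+x\<in>K. (\<integral>\<^sup>+y\<in>K. ennreal (g y * (u x - u y)\<^sup>2) \<partial>lborel) \<partial>lborel)
     \<le> (\<integral>\<^sup>+x. ennreal A * (ennreal (2 / r\<^sup>2) * (I x * indicator K x) + 32 * J * indicator K x) \<partial>lborel)"
    using inner by (intro nn_integral_mono) (auto simp: indicator_def)
  also have "\<dots> = ennreal A * (ennreal (2 / r\<^sup>2) * (\<integral>\<^sup>+x\<in>K. I x \<partial>lborel) + 32 * J * emeasure lborel K)"
    using mI by (simp add: nn_integral_cmult nn_integral_add nn_integral_cmult_indicator)
  also have "\<dots> \<le> ennreal A * (ennreal (2 / r\<^sup>2) * (ennreal ((n * r)\<^sup>2 * 2 ^ n) * emeasure lborel K * J) + 32 * J * emeasure lborel K)"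
    unfolding I_def J_def n_def using poincare_double_cube[OF r K u Du]
    by (intro mult_left_mono add_right_mono) auto
  also have "ennreal (2 / r\<^sup>2) * (ennreal ((n * r)\<^sup>2 * 2 ^ n) * emeasure lborel K * J)
     = ennreal (2 * (real n)\<^sup>2 * 2 ^ n) * emeasure lborel K * J"
    using r by (simp add: ennreal_mult[symmetric] mult.assoc[symmetric] power_mult_distrib)
  also have "ennreal A * (\<dots> + 32 * J * emeasure lborel K) = ennreal (poincare_constant n * A) * emeasure lborel K * J"
    using A(1) by (simp add: poincare_constant_def ennreal_mult ennreal_plus distrib_left distrib_right mult_ac)
  finally show ?thesis unfolding J_def .
qed

text \<open>On \<open>Q\<close> itself \<open>u\<close> may be unbounded, so the closed case is applied to concentric closed cubes that
  increase to \<open>Q\<close>, where the bound for the weight on \<open>Q\<close> remains valid. The order of integration is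
  exchanged on the way, since the closed case integrates the variable of the weight first.\<close>

lemma weighted_poincare_open_cube:
  fixes u g :: "'a::euclidean_space \<Rightarrow> real" and A r :: real
  defines "n \<equiv> DIM('a)"
  assumes n: "3 \<le> n" and r: "0 < r" and Q: "Q = box a (a + r *\<^sub>R One)"
    and u: "\<And>x. x \<in> Q \<Longrightarrow> (u has_derivative (\<lambda>h. Du x \<bullet> h)) (at x)"
    and Du: "continuous_on Q Du"
    and g[measurable]: "g \<in> borel_measurable borel" and g0: "\<And>x. 0 \<le> g x"
    and A: "0 \<le> A" "(\<integral>\<^sup>+y\<in>Q. ennreal (g y powr (n / 2)) \<partial>lborel) \<le> ennreal (A powr (n / 2))"
  shows "(\<integral>\<^sup>+y\<in>Q. (\<integral>\<^sup>+x\<in>Q. ennreal (g y * (u x - u y)\<^sup>2) \<partial>lborel) \<partial>lborel)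
     \<le> ennreal (poincare_constant n * A) * emeasure lborel Q
        * (\<integral>\<^sup>+y\<in>Q. ennreal ((norm (Du y))\<^sup>2) \<partial>lborel)" (is "_ \<le> ?R")
proof -
  \<comment> \<open>The offset 3 keeps \<open>2 \<epsilon>\<close> strictly below \<open>r\<close>, so that no closed cube degenerates.\<close>
  define \<epsilon> where "\<epsilon> j = r / (real j + 3)" for j
  define K where "K j = cbox (a + \<epsilon> j *\<^sub>R One) (a + \<epsilon> j *\<^sub>R One + (r - 2 * \<epsilon> j) *\<^sub>R One)" for j
  have \<epsilon>: "0 < \<epsilon> j" "0 < r - 2 * \<epsilon> j" for j using r by (auto simp: \<epsilon>_def field_simps intro!: add_pos_nonneg)
  have memK: "x \<in> K j \<longleftrightarrow> (\<forall>b\<in>Basis. a \<bullet> b + \<epsilon> j \<le> x \<bullet> b \<and> x \<bullet> b \<le> a \<bullet> b + r - \<epsilon> j)" for x j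
    by (auto simp: K_def mem_cube inner_simps)
  have memQ: "x \<in> Q \<longleftrightarrow> (\<forall>b\<in>Basis. a \<bullet> b < x \<bullet> b \<and> x \<bullet> b < a \<bullet> b + r)" for x
    by (auto simp: Q mem_box inner_simps)
  have KQ: "K j \<subseteq> Q" for j
    using \<epsilon>(1)[of j] by (force simp: memK memQ)
  have "decseq \<epsilon>" unfolding \<epsilon>_def using r by (intro decseq_SucI) (auto intro!: divide_left_mono)
  then have incK: "incseq K"
    unfolding incseq_def decseq_def by (force simp: memK)
  have evK: "eventually (\<lambda>j. x \<in> K j) sequentially" if x: "x \<in> Q" for x
  proof -
    have "\<epsilon> \<longlonglongrightarrow> 0" unfolding \<epsilon>_def
      using LIMSEQ_ignore_initial_segment[OF lim_const_over_n[of r], of 3] by simp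
    then have "eventually (\<lambda>j. \<epsilon> j < x \<bullet> b - a \<bullet> b) sequentially"
              "eventually (\<lambda>j. \<epsilon> j < a \<bullet> b + r - x \<bullet> b) sequentially" if "b \<in> Basis" for b
      using x that by (auto simp: memQ intro!: order_tendstoD(2)[of \<epsilon> 0])
    then have "eventually (\<lambda>j. \<forall>b\<in>Basis. \<epsilon> j < x \<bullet> b - a \<bullet> b \<and> \<epsilon> j < a \<bullet> b + r - x \<bullet> b) sequentially"
      by (intro eventually_ball_finite) (auto intro: eventually_conj)
    then show ?thesis by eventually_elim (force simp: memK)
  qed
  have [measurable]: "Q \<in> sets borel" "K j \<in> sets borel" for j by (auto simp: Q K_def)
  have cu: "continuous_on Q u"
    using u by (meson has_derivative_continuous continuous_at_imp_continuous_on)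
  define w where "w x = indicator Q x *\<^sub>R u x" for x
  have [measurable]: "w \<in> borel_measurable borel"
    unfolding w_def using cu by (intro borel_measurable_continuous_on_indicator) auto
  define \<Phi> where "\<Phi> j y x = ennreal (g y * (w x - w y)\<^sup>2) * indicator (K j) x * indicator (K j) y" for j y x
  have m\<Phi>[measurable (raw)]: "(\<lambda>z. \<Phi> j (b z) (c z)) \<in> borel_measurable M"
    if [measurable]: "b \<in> borel_measurable M" "c \<in> borel_measurable M" for b c M j
    unfolding \<Phi>_def by measurable
  have inc\<Phi>: "\<Phi> j y x \<le> \<Phi> k y x" if "j \<le> k" for j k x y
    using incK that by (auto simp: \<Phi>_def incseq_def indicator_def)
  have sup\<Phi>: "(SUP j. \<Phi> j y x) = ennreal (g y * (u x - u y)\<^sup>2) * indicator Q x * indicator Q y" for x y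
  proof (cases "x \<in> Q \<and> y \<in> Q")
    case True
    then obtain j where j: "x \<in> K j" "y \<in> K j"
      using eventually_conj[OF evK[of x] evK[of y]] by (auto simp: eventually_sequentially)
    have "(SUP j. \<Phi> j y x) = ennreal (g y * (u x - u y)\<^sup>2)"
    proof (rule antisym)
      show "(SUP j. \<Phi> j y x) \<le> ennreal (g y * (u x - u y)\<^sup>2)"
        using True by (intro SUP_least) (auto simp: \<Phi>_def w_def indicator_def)
      have "ennreal (g y * (u x - u y)\<^sup>2) = \<Phi> j y x" using True j by (simp add: \<Phi>_def w_def)
      then show "ennreal (g y * (u x - u y)\<^sup>2) \<le> (SUP j. \<Phi> j y x)" by (metis SUP_upper UNIV_I)
    qed
    then show ?thesis using True by simp
  next
    case False
    then have "\<Phi> j y x = 0" for j using KQ[of j] by (auto simp: \<Phi>_def indicator_def)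
    then show ?thesis using False by (auto simp: indicator_def)
  qed
  have ps: "pair_sigma_finite (lborel :: 'a measure) (lborel :: 'a measure)"
    by unfold_locales
  have "(\<integral>\<^sup>+y\<in>Q. (\<integral>\<^sup>+x\<in>Q. ennreal (g y * (u x - u y)\<^sup>2) \<partial>lborel) \<partial>lborel)
      = (\<integral>\<^sup>+y. (\<integral>\<^sup>+x. (SUP j. \<Phi> j y x) \<partial>lborel) \<partial>lborel)"
    unfolding sup\<Phi> by (intro nn_integral_cong) (auto simp: indicator_def)
  also have "\<dots> = (\<integral>\<^sup>+y. (SUP j. \<integral>\<^sup>+x. \<Phi> j y x \<partial>lborel) \<partial>lborel)"
    by (intro nn_integral_cong nn_integral_monotone_convergence_SUP) (auto simp: incseq_def le_fun_def inc\<Phi>)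
  also have "\<dots> = (SUP j. \<integral>\<^sup>+y. \<integral>\<^sup>+x. \<Phi> j y x \<partial>lborel \<partial>lborel)"
    by (intro nn_integral_monotone_convergence_SUP) (auto simp: incseq_def le_fun_def intro!: nn_integral_mono inc\<Phi>)
  also have "\<dots> \<le> ?R"
  proof (rule SUP_least)
    fix j
    have uK: "(u has_derivative (\<lambda>h. Du x \<bullet> h)) (at x within K j)" if "x \<in> K j" for x
      using u KQ[of j] that by (auto intro: has_derivative_at_withinI)
    have AK: "(\<integral>\<^sup>+y\<in>K j. ennreal (g y powr (real DIM('a) / 2)) \<partial>lborel) \<le> ennreal (A powr (real DIM('a) / 2))"
    proof -
      have "(\<integral>\<^sup>+y\<in>K j. ennreal (g y powr (n / 2)) \<partial>lborel) \<le> (\<integral>\<^sup>+y\<in>Q. ennreal (g y powr (n / 2)) \<partial>lborel)"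
        using KQ[of j] by (intro nn_integral_mono) (auto simp: indicator_def)
      then show ?thesis using A(2) by (simp add: n_def)
    qed
    have "(\<integral>\<^sup>+y. \<integral>\<^sup>+x. \<Phi> j y x \<partial>lborel \<partial>lborel) = (\<integral>\<^sup>+x. \<integral>\<^sup>+y. \<Phi> j y x \<partial>lborel \<partial>lborel)"
      by (rule pair_sigma_finite.Fubini'[OF ps]) measurable
    also have "\<dots> = (\<integral>\<^sup>+x\<in>K j. (\<integral>\<^sup>+y\<in>K j. ennreal (g y * (u x - u y)\<^sup>2) \<partial>lborel) \<partial>lborel)"
    proof (rule nn_integral_cong)
      fix x
      show "(\<integral>\<^sup>+y. \<Phi> j y x \<partial>lborel) = (\<integral>\<^sup>+y\<in>K j. ennreal (g y * (u x - u y)\<^sup>2) \<partial>lborel) * indicator (K j) x"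
      proof (cases "x \<in> K j")
        case True
        then show ?thesis using KQ[of j] by (auto simp: \<Phi>_def w_def indicator_def intro!: nn_integral_cong)
      qed (simp add: \<Phi>_def)
    qed
    also have "\<dots> \<le> ennreal (poincare_constant n * A) * emeasure lborel (K j)
        * (\<integral>\<^sup>+y\<in>K j. ennreal ((norm (Du y))\<^sup>2) \<partial>lborel)"
      unfolding n_def
      by (rule weighted_poincare_closed_cube[OF n[unfolded n_def] \<epsilon>(2) K_def uK continuous_on_subset[OF Du KQ] g g0 A(1) AK])
    also have "\<dots> \<le> ?R"
      using KQ[of j] by (intro mult_mono emeasure_mono nn_integral_mono) (auto simp: indicator_def)
    finally show "(\<integral>\<^sup>+y. \<integral>\<^sup>+x. \<Phi> j y x \<partial>lborel \<partial>lborel) \<le> ?R" .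
  qed
  finally show ?thesis .
qed

section \<open>Square roots of positive semidefinite matrices\<close>

lemma symmetric_matrix_inner:
  fixes A :: "real^'d^'d"
  assumes "transpose A = A"
  shows "(A *v x) \<bullet> y = x \<bullet> (A *v y)"
  by (metis assms dot_lmul_matrix vector_transpose_matrix)

text \<open>A maximiser \<open>e\<close> of the quadratic form on the unit sphere is an eigenvector: the form
  \<open>q(x) = l |x|\<^sup>2 - \<langle>A x, x\<rangle>\<close> is nonnegative and vanishes at \<open>e\<close>, so its first variation there,
  which is represented by \<open>h = l e - A e\<close>, vanishes.\<close>

lemma symmetric_matrix_max_eigenvector:
  fixes A :: "real^'d^'d"
  assumes A: "transpose A = A"
  obtains e l where "norm e = 1" "A *v e = l *\<^sub>R e" "\<And>x. (A *v x) \<bullet> x \<le> l * (norm x)\<^sup>2"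
proof -
  have "axis undefined 1 \<in> sphere (0::real^'d) 1" by (simp add: norm_axis_1)
  moreover have "continuous_on (sphere 0 1) (\<lambda>x. (A *v x) \<bullet> x)"
    by (intro continuous_intros)
  ultimately obtain e where e: "norm e = 1" and emax: "\<And>x. norm x = 1 \<Longrightarrow> (A *v x) \<bullet> x \<le> (A *v e) \<bullet> e"
    using continuous_attains_sup[of "sphere (0::real^'d) 1" "\<lambda>x. (A *v x) \<bullet> x"] by fastforce
  define l where "l = (A *v e) \<bullet> e"
  define q where "q x = l * (x \<bullet> x) - (A *v x) \<bullet> x" for x
  have q0: "0 \<le> q x" for x
  proof (cases "x = 0")
    case False
    define y where "y = x /\<^sub>R norm x"
    have y: "norm y = 1" "x = norm x *\<^sub>R y" using False by (auto simp: y_def)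
    have "(A *v x) \<bullet> x = (norm x)\<^sup>2 * ((A *v y) \<bullet> y)"
      by (subst (1 2) y(2)) (simp add: matrix_vector_mult_scaleR power2_eq_square)
    also have "\<dots> \<le> (norm x)\<^sup>2 * l" using emax[OF y(1)] by (intro mult_left_mono) (auto simp: l_def)
    finally show ?thesis by (simp add: q_def power2_norm_eq_inner mult.commute)
  qed (simp add: q_def)
  define h where "h = l *\<^sub>R e - A *v e"
  have ee: "e \<bullet> e = 1" using e by (simp add: norm_eq_1)
  have expand: "q (e + t *\<^sub>R h) = 2 * t * (h \<bullet> h) + t\<^sup>2 * q h" for t
  proof -
    have "(A *v h) \<bullet> e = (A *v e) \<bullet> h"
      by (metis symmetric_matrix_inner[OF A] inner_commute)
    then have "q (e + t *\<^sub>R h) = q e + 2 * t * (l * (e \<bullet> h) - (A *v e) \<bullet> h) + t\<^sup>2 * q h"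
      by (simp add: q_def matrix_vector_right_distrib matrix_vector_mult_scaleR inner_simps
          inner_commute[of h e] algebra_simps power2_eq_square)
    moreover have "q e = 0" by (simp add: q_def ee l_def)
    moreover have "l * (e \<bullet> h) - (A *v e) \<bullet> h = h \<bullet> h"
      by (simp add: h_def inner_simps inner_commute[of "A *v e" e])
    ultimately show ?thesis by simp
  qed
  have "h = 0"
  proof (rule ccontr)
    assume "h \<noteq> 0"
    then have hh: "0 < h \<bullet> h" by simp
    \<comment> \<open>A step against \<open>h\<close> this short has a linear gain \<open>2 s |h|\<^sup>2\<close> that exceeds the quadratic cost \<open>s\<^sup>2 q(h)\<close>.\<close>
    define s where "s = (h \<bullet> h) / (q h + 1)"
    have s: "0 < s" using hh q0[of h] by (simp add: s_def)
    have "0 \<le> 2 * (- s) * (h \<bullet> h) + (- s)\<^sup>2 * q h" using q0[of "e + (- s) *\<^sub>R h"] unfolding expand .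
    then have "0 \<le> s * (s * q h - 2 * (h \<bullet> h))" by (simp add: power2_eq_square algebra_simps)
    then have "2 * (h \<bullet> h) \<le> s * q h" using s by (simp add: zero_le_mult_iff)
    moreover have "s * (q h + 1) = h \<bullet> h" using q0[of h] by (simp add: s_def)
    ultimately show False using s hh by (simp add: distrib_left)
  qed
  then have "A *v e = l *\<^sub>R e" by (simp add: h_def)
  moreover have "(A *v x) \<bullet> x \<le> l * (norm x)\<^sup>2" for x
    using q0[of x] by (simp add: q_def power2_norm_eq_inner)
  ultimately show ?thesis using that e by blast
qed

lemma symmetric_matrix_eq_0:
  fixes D :: "real^'d^'d"
  assumes D: "transpose D = D" and 0: "\<And>x. (D *v x) \<bullet> x = 0"
  shows "D = 0"
proof -
  have "D *v x = 0" for x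
  proof -
    let ?y = "D *v x"
    have "(D *v (x + ?y)) \<bullet> (x + ?y) = (D *v x) \<bullet> x + 2 * (?y \<bullet> ?y) + (D *v ?y) \<bullet> ?y"
      using symmetric_matrix_inner[OF D, of ?y x]
      by (simp add: matrix_vector_right_distrib inner_simps inner_commute)
    then show ?thesis by (simp add: 0)
  qed
  then show ?thesis by (simp add: matrix_eq)
qed

definition outer_square :: "real^'d \<Rightarrow> real^'d^'d" where
  "outer_square e = (\<chi> i j. e $ i * e $ j)"

lemma outer_square_mult: "outer_square e *v x = (e \<bullet> x) *\<^sub>R e"
  by (simp add: outer_square_def matrix_vector_mult_def vec_eq_iff inner_vec_def sum_distrib_left mult_ac)

lemma transpose_outer_square: "transpose (outer_square e) = outer_square e"
  by (simp add: outer_square_def transpose_def mult.commute)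

lemma transpose_add: "transpose (A + B) = transpose A + transpose (B :: real^'n^'m)"
  by (simp add: transpose_def vec_eq_iff)

lemma transpose_diff: "transpose (A - B) = transpose A - transpose (B :: real^'n^'m)"
  by (simp add: transpose_def vec_eq_iff)

text \<open>Splitting off the top eigenvalue, \<open>A = A' + l e e\<^sup>T\<close>, leaves a positive semidefinite \<open>A'\<close> with a larger
  kernel. If \<open>B\<close> is a root of \<open>A'\<close>, then \<open>B e = 0\<close>, because \<open>|B e|\<^sup>2 = \<langle>A' e, e\<rangle> = 0\<close>, so the cross
  terms in the square of \<open>B + l\<^bsup>1/2\<^esup> e e\<^sup>T\<close> disappear.\<close>

lemma psd_matrix_sqrt_exists:
  fixes A :: "real^'d^'d"
  assumes "psd_matrix A"
  shows "\<exists>B. psd_matrix B \<and> B ** B = A"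
  using assms
proof (induction "CARD('d) - dim {x. A *v x = 0}" arbitrary: A rule: less_induct)
  case less
  have sym: "transpose A = A" and psd: "\<And>x. 0 \<le> (A *v x) \<bullet> x"
    using less.prems by (auto simp: psd_matrix_def)
  obtain e l where e: "norm e = 1" and ev: "A *v e = l *\<^sub>R e" and max: "\<And>x. (A *v x) \<bullet> x \<le> l * (norm x)\<^sup>2"
    using symmetric_matrix_max_eigenvector[OF sym] by blast
  have ee: "e \<bullet> e = 1" using e by (simp add: norm_eq_1)
  show ?case
  proof (cases "0 < l")
    case False
    have "A = 0"
    proof (rule symmetric_matrix_eq_0[OF sym])
      fix x :: "real^'d"
      have "l * (norm x)\<^sup>2 \<le> 0" using False by (simp add: mult_le_0_iff)
      then show "(A *v x) \<bullet> x = 0" using max[of x] psd[of x] by linarith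
    qed
    then show ?thesis using less.prems by (intro exI[of _ 0]) auto
  next
    case l: True
    define A' where "A' = A + (- l) *\<^sub>R outer_square e"
    have A'x: "A' *v x = A *v x - (l * (e \<bullet> x)) *\<^sub>R e" for x
      by (simp add: A'_def matrix_vector_mult_diff_rdistrib scaleR_matrix_vector_assoc[symmetric] outer_square_mult)
    have eAx: "e \<bullet> (A *v x) = l * (e \<bullet> x)" for x
      using symmetric_matrix_inner[OF sym, of e x] by (simp add: ev)
    have psd': "psd_matrix A'"
      unfolding psd_matrix_def
    proof (intro conjI allI)
      show "transpose A' = A'"
        by (simp add: A'_def transpose_diff sym transpose_outer_square transpose_scalar)
      fix x
      define y where "y = x - (e \<bullet> x) *\<^sub>R e"
      have "(A *v y) \<bullet> y = (A *v x) \<bullet> x - l * (e \<bullet> x)\<^sup>2"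
        using eAx[of x] by (simp add: y_def matrix_vector_mult_diff_distrib matrix_vector_mult_scaleR ev inner_simps
            ee inner_commute power2_eq_square algebra_simps)
      also have "\<dots> = (A' *v x) \<bullet> x"
        by (simp add: A'x inner_simps power2_eq_square)
      finally show "0 \<le> (A' *v x) \<bullet> x" using psd[of y] by simp
    qed
    have A'e: "A' *v e = 0" by (simp add: A'x ev ee)
    have "{x. A *v x = 0} \<subset> {x. A' *v x = 0}"
    proof
      show "{x. A *v x = 0} \<subseteq> {x. A' *v x = 0}"
      proof clarify
        fix x assume "A *v x = 0"
        moreover from this have "l * (e \<bullet> x) = 0" using eAx[of x] by simp
        ultimately show "A' *v x = 0" by (simp only: A'x) simp
      qed
      have "A *v e \<noteq> 0" using l e by (auto simp: ev)
      then show "{x. A *v x = 0} \<noteq> {x. A' *v x = 0}" using A'e by auto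
    qed
    moreover have sub: "subspace {x. M *v x = 0}" for M :: "real^'d^'d"
      by (simp add: subspace_def matrix_vector_right_distrib matrix_vector_mult_scaleR)
    ultimately have "dim {x. A *v x = 0} < dim {x. A' *v x = 0}"
      by (metis dim_psubset span_eq_iff)
    moreover have "dim {x. A' *v x = 0} \<le> CARD('d)"
      using dim_subset_UNIV[of "{x. A' *v x = 0}"] by simp
    ultimately have "CARD('d) - dim {x. A' *v x = 0} < CARD('d) - dim {x. A *v x = 0}" by linarith
    from less.hyps[OF this psd'] obtain B where B: "psd_matrix B" "B ** B = A'" by blast
    have symB: "transpose B = B" and psdB: "\<And>x. 0 \<le> (B *v x) \<bullet> x" using B(1) by (auto simp: psd_matrix_def)
    have BB: "B *v (B *v x) = A' *v x" for x by (simp add: B(2)[symmetric] matrix_vector_mul_assoc)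
    have "(B *v e) \<bullet> (B *v e) = e \<bullet> (B *v (B *v e))" by (rule symmetric_matrix_inner[OF symB])
    then have Be: "B *v e = 0" by (simp add: BB A'e)
    have eB: "e \<bullet> (B *v x) = 0" for x using symmetric_matrix_inner[OF symB, of e x] by (simp add: Be)
    define C where "C = B + sqrt l *\<^sub>R outer_square e"
    have Cx: "C *v x = B *v x + (sqrt l * (e \<bullet> x)) *\<^sub>R e" for x
      by (simp add: C_def matrix_vector_mult_add_rdistrib scaleR_matrix_vector_assoc[symmetric] outer_square_mult)
    have "psd_matrix C"
      unfolding psd_matrix_def
    proof (intro conjI allI)
      show "transpose C = C"
        by (simp add: C_def transpose_add symB transpose_outer_square transpose_scalar)
      fix x
      show "0 \<le> (C *v x) \<bullet> x" using psdB[of x] l by (simp add: Cx inner_simps mult.assoc)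
    qed
    moreover have "C ** C = A"
    proof -
      have "C *v (C *v x) = A *v x" for x
        using l by (simp add: Cx matrix_vector_right_distrib matrix_vector_mult_scaleR BB Be eB inner_simps ee A'x mult.assoc[symmetric])
      then show ?thesis by (simp add: matrix_eq matrix_vector_mul_assoc)
    qed
    ultimately show ?thesis by blast
  qed
qed

text \<open>This gives uniqueness of the root, by exchanging the two matrices. Let \<open>e\<close> be a top unit eigenvector
  of \<open>B - C\<close> with eigenvalue \<open>l\<close>. From \<open>|B e| = |C e|\<close> one gets \<open>l (\<langle>B e, e\<rangle> + \<langle>C e, e\<rangle>) = 0\<close>. The two
  numbers in the sum are nonnegative and \<open>l\<close> is their difference, so \<open>l = 0\<close>.\<close>

lemma psd_matrix_sqrt_diff_le_0:
  fixes B C :: "real^'d^'d"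
  assumes B: "psd_matrix B" and C: "psd_matrix C" and eq: "B ** B = C ** C"
  shows "((B - C) *v x) \<bullet> x \<le> 0"
proof -
  have sym: "transpose B = B" "transpose C = C" using B C by (auto simp: psd_matrix_def)
  have symD: "transpose (B - C) = B - C" using sym by (simp add: transpose_diff)
  obtain e l where e: "norm e = 1" and ev: "(B - C) *v e = l *\<^sub>R e"
    and max: "\<And>x. ((B - C) *v x) \<bullet> x \<le> l * (norm x)\<^sup>2"
    using symmetric_matrix_max_eigenvector[OF symD] by blast
  have ev': "B *v e - C *v e = l *\<^sub>R e" using ev by (simp add: matrix_vector_mult_diff_rdistrib)
  have "(B *v e) \<bullet> (B *v e) = (C *v e) \<bullet> (C *v e)"
    using eq by (simp add: symmetric_matrix_inner sym matrix_vector_mul_assoc)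
  then have "(B *v e - C *v e) \<bullet> (B *v e + C *v e) = 0"
    by (simp add: inner_simps inner_commute)
  then have "l * ((B *v e) \<bullet> e + (C *v e) \<bullet> e) = 0"
    unfolding ev' by (simp add: inner_simps inner_commute distrib_left)
  moreover have pos: "0 \<le> (B *v e) \<bullet> e" "0 \<le> (C *v e) \<bullet> e" using B C by (auto simp: psd_matrix_def)
  moreover have "l = (B *v e) \<bullet> e - (C *v e) \<bullet> e"
    using arg_cong[OF ev', of "\<lambda>x. x \<bullet> e"] e by (simp add: inner_simps norm_eq_1)
  ultimately have "l = 0" by auto
  then show ?thesis using max[of x] by simp
qed

lemma psd_sqrt_works:
  assumes "psd_matrix A"
  shows "psd_matrix (psd_sqrt A)" "psd_sqrt A ** psd_sqrt A = A"
proof -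
  have "B = C" if "psd_matrix B" "B ** B = A" "psd_matrix C" "C ** C = A" for B C
  proof -
    have eq: "B ** B = C ** C" using that by simp
    have "B - C = 0"
    proof (rule symmetric_matrix_eq_0)
      show "transpose (B - C) = B - C" using that by (simp add: psd_matrix_def transpose_diff)
      fix x
      have "((B - C) *v x) \<bullet> x = - (((C - B) *v x) \<bullet> x)"
        by (simp add: matrix_vector_mult_diff_rdistrib inner_simps)
      then show "((B - C) *v x) \<bullet> x = 0"
        using psd_matrix_sqrt_diff_le_0[OF that(1,3) eq, of x]
          psd_matrix_sqrt_diff_le_0[OF that(3,1) eq[symmetric], of x] by linarith
    qed
    then show ?thesis by simp
  qed
  then have "\<exists>!B. psd_matrix B \<and> B ** B = A"
    using psd_matrix_sqrt_exists[OF assms] by blast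
  from theI'[OF this] show "psd_matrix (psd_sqrt A)" "psd_sqrt A ** psd_sqrt A = A"
    by (auto simp: psd_sqrt_def)
qed

text \<open>The vectors \<open>f\<^sub>i = W\<^bsup>-1/2\<^esup> e\<^sub>i\<close> work: the \<open>i\<close>-th component of \<open>W\<^bsup>-1/2\<^esup> M\<^bsup>1/2\<^esup> \<xi>\<close> is
  \<open>\<langle>M\<^bsup>1/2\<^esup> f\<^sub>i, \<xi>\<rangle>\<close>, to which Cauchy-Schwarz applies. They do not depend on \<open>M\<close>, which makes the sum
  on the right a fixed linear functional of \<open>M\<close>.\<close>

lemma norm_normalised_sqrt_le:
  fixes W :: "real^'d^'d"
  assumes W: "pd_matrix W"
  obtains f :: "'d \<Rightarrow> real^'d" where "\<And>i. (W *v f i) \<bullet> f i = 1"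
    "\<And>M \<xi>. psd_matrix M \<Longrightarrow>
      (norm ((matrix_inv (psd_sqrt W) ** psd_sqrt M) *v \<xi>))\<^sup>2 \<le> (\<Sum>i\<in>UNIV. (M *v f i) \<bullet> f i) * (norm \<xi>)\<^sup>2"
proof -
  define R where "R = psd_sqrt W"
  define T where "T = matrix_inv R"
  \<comment> \<open>The transpose spares a proof that the inverse of a symmetric matrix is symmetric.\<close>
  define f where "f i = transpose T *v axis i 1" for i
  have "0 \<le> (W *v x) \<bullet> x" for x using W by (cases "x = 0") (auto simp: pd_matrix_def less_imp_le)
  then have "psd_matrix W" using W by (simp add: psd_matrix_def pd_matrix_def)
  then have R: "transpose R = R" "R ** R = W" using psd_sqrt_works[of W] by (auto simp: R_def psd_matrix_def)
  have "x = 0" if "R *v x = 0" for x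
  proof (rule ccontr)
    assume "x \<noteq> 0"
    then have "0 < (W *v x) \<bullet> x" using W by (simp add: pd_matrix_def)
    moreover have "W *v x = R *v (R *v x)" by (simp add: R(2)[symmetric] matrix_vector_mul_assoc)
    ultimately show False using that by simp
  qed
  then have "invertible R"
    using invertible_left_inverse matrix_left_invertible_ker by blast
  then have TR: "T ** R = mat 1" unfolding T_def matrix_inv_def invertible_def by (rule someI2_ex) simp
  have "R *v f i = axis i 1" for i
  proof -
    have "(R *v f i) \<bullet> y = axis i 1 \<bullet> y" for y
    proof -
      have "(R *v f i) \<bullet> y = axis i 1 \<bullet> (T *v (R *v y))"
        by (simp add: symmetric_matrix_inner[OF R(1)] f_def dot_lmul_matrix)
      then show ?thesis by (simp add: matrix_vector_mul_assoc TR)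
    qed
    then show ?thesis using vector_eq_rdot by blast
  qed
  moreover have "(W *v f i) \<bullet> f i = (R *v f i) \<bullet> (R *v f i)" for i
    by (simp add: symmetric_matrix_inner[OF R(1)] R(2) matrix_vector_mul_assoc inner_commute)
  ultimately have 1: "(W *v f i) \<bullet> f i = 1" for i by (simp add: inner_axis_axis)
  have 2: "(norm ((T ** psd_sqrt M) *v \<xi>))\<^sup>2 \<le> (\<Sum>i\<in>UNIV. (M *v f i) \<bullet> f i) * (norm \<xi>)\<^sup>2"
    if M: "psd_matrix M" for M \<xi>
  proof -
    define S where "S = psd_sqrt M"
    have S: "transpose S = S" "S ** S = M" using psd_sqrt_works[OF M] by (auto simp: S_def psd_matrix_def)
    have comp: "(((T ** S) *v \<xi>) $ i)\<^sup>2 \<le> ((M *v f i) \<bullet> f i) * (norm \<xi>)\<^sup>2" for i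
    proof -
      have "((T ** S) *v \<xi>) $ i = axis i 1 \<bullet> (T *v (S *v \<xi>))"
        by (simp add: inner_axis' matrix_vector_mul_assoc)
      also have "\<dots> = f i \<bullet> (S *v \<xi>)"
        by (simp add: f_def dot_lmul_matrix[symmetric])
      also have "\<dots> = (S *v f i) \<bullet> \<xi>" by (simp add: symmetric_matrix_inner[OF S(1)])
      finally have "(((T ** S) *v \<xi>) $ i)\<^sup>2 \<le> ((S *v f i) \<bullet> (S *v f i)) * (\<xi> \<bullet> \<xi>)"
        using Cauchy_Schwarz_ineq by metis
      also have "(S *v f i) \<bullet> (S *v f i) = (M *v f i) \<bullet> f i"
        by (simp add: symmetric_matrix_inner[OF S(1)] S(2)[symmetric] matrix_vector_mul_assoc inner_commute)
      finally show ?thesis by (simp add: power2_norm_eq_inner)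
    qed
    have "(norm ((T ** S) *v \<xi>))\<^sup>2 = (\<Sum>i\<in>UNIV. (((T ** S) *v \<xi>) $ i)\<^sup>2)"
      unfolding power2_norm_eq_inner inner_vec_def by (simp add: power2_eq_square)
    also have "\<dots> \<le> (\<Sum>i\<in>UNIV. ((M *v f i) \<bullet> f i) * (norm \<xi>)\<^sup>2)" by (intro sum_mono comp)
    finally show ?thesis by (simp add: S_def sum_distrib_right)
  qed
  show ?thesis using that[of f] 1 2 by (simp add: T_def R_def)
qed

section \<open>Matrix weights\<close>

lemma One_vec_nth: "(One :: real^'n) $ i = 1"
proof -
  have "(One :: real^'n) $ i = (One :: real^'n) \<bullet> axis i 1" by (rule cart_eq_inner_axis)
  also have "\<dots> = 1" by (rule inner_sum_Basis) simp
  finally show ?thesis .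
qed

lemma open_cube_eq_box:
  "(box a (\<chi> i. a $ i + r)) = box a (a + r *\<^sub>R One)" for a :: "real^'n"
proof -
  have "(\<chi> i. a $ i + r) = a + r *\<^sub>R One" by (simp add: vec_eq_iff One_vec_nth del: sum_component)
  then show ?thesis by simp
qed

lemma open_cube_measure:
  fixes Q :: "(real^'b) set"
  assumes "open_cube Q"
  shows "open Q" "bounded Q" "0 < measure lebesgue Q" "emeasure lborel Q = ennreal (measure lebesgue Q)"
proof -
  obtain a r where r: "0 < r" and Q: "Q = box a (a + r *\<^sub>R One)"
    using assms by (auto simp: open_cube_def open_cube_eq_box)
  show "open Q" "bounded Q" by (auto simp: Q)
  have "emeasure lborel Q = (\<Prod>b\<in>(Basis::(real^'b) set). r)"
    using r by (simp add: Q inner_simps cong: prod.cong)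
  then have *: "emeasure lborel Q = ennreal (r ^ CARD('b))" using r by simp
  then have "measure lebesgue Q = r ^ CARD('b)" using r by (simp add: measure_def Q)
  then show "0 < measure lebesgue Q" "emeasure lborel Q = ennreal (measure lebesgue Q)"
    using r * by auto
qed

lemma locally_Lp_set_integrable:
  assumes V: "locally_Lp p V" and Q: "open Q" "bounded Q"
  shows "set_integrable lebesgue Q (\<lambda>x. norm (V x) powr p)"
proof -
  have "set_integrable lebesgue (closure Q) (\<lambda>x. norm (V x) powr p)"
    using V Q by (simp add: locally_Lp_def)
  then show ?thesis
    by (rule set_integrable_subset) (use Q in \<open>auto simp: closure_subset\<close>)
qed

text \<open>This provides the integrability under which the nondegeneracy condition makes \<open>V(Q)\<close> positive
  definite.\<close>

lemma locally_Lp_set_integrable_weight: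
  assumes V: "locally_Lp p V" and Q: "open Q" "bounded Q" and p: "1 \<le> p"
  shows "set_integrable lebesgue Q V"
  unfolding set_integrable_def
proof (rule Bochner_Integration.integrable_bound)
  have "emeasure lebesgue Q < \<infinity>"
    using emeasure_bounded_finite[OF Q(2)] Q(1) by simp
  then have "set_integrable lebesgue Q (\<lambda>x. 1::real)"
    using Q(1) by (simp add: set_integrable_def)
  then have "set_integrable lebesgue Q (\<lambda>x. 1 + norm (V x) powr p)"
    by (intro set_integral_add locally_Lp_set_integrable[OF V Q])
  then show "integrable lebesgue (\<lambda>x. indicator Q x *\<^sub>R (1 + norm (V x) powr p))"
    by (simp add: set_integrable_def)
  have "V \<in> borel_measurable lebesgue" using V by (simp add: locally_Lp_def)
  moreover have "Q \<in> sets lebesgue" using Q(1) by simp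
  ultimately show "(\<lambda>x. indicator Q x *\<^sub>R V x) \<in> borel_measurable lebesgue" by measurable
  have "norm (V x) \<le> 1 + norm (V x) powr p" for x
  proof (cases "norm (V x) \<le> 1")
    case False
    then have "norm (V x) powr 1 \<le> norm (V x) powr p" using p by (intro powr_mono) auto
    then show ?thesis by simp
  qed (simp add: add_increasing2)
  then show "AE x in lebesgue. norm (indicator Q x *\<^sub>R V x) \<le> norm (indicator Q x *\<^sub>R (1 + norm (V x) powr p))"
    by (intro AE_I2) (simp add: indicator_def abs_of_nonneg)
qed

lemma linear_quadratic_form: "linear (\<lambda>A :: real^'d^'d. (A *v f) \<bullet> f)"
  by (rule linearI) (simp_all add: matrix_vector_mult_add_rdistrib scaleR_matrix_vector_assoc[symmetric] inner_simps)

lemma measurable_quadratic_form: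
  fixes V :: "'x \<Rightarrow> real^'d^'d"
  assumes "V \<in> borel_measurable M"
  shows "(\<lambda>x. (V x *v f) \<bullet> f) \<in> borel_measurable M"
  by (rule measurable_compose[OF assms])
    (intro borel_measurable_continuous_onI linear_continuous_on linear_conv_bounded_linear[THEN iffD1] linear_quadratic_form)

text \<open>The normalisation \<open>\<langle>V(Q) f, f\<rangle> = 1\<close> turns the right-hand side of the reverse Hoelder condition
  into \<open>C/|Q|\<close>; the rest is a rearrangement. For \<open>p = n/2\<close> the bound times \<open>|Q|\<close> is \<open>C |Q|\<^bsup>2/n\<^esup>\<close>,
  which is the scaling of the final inequality.\<close>

lemma reverse_hoelder_normalised:
  fixes V :: "real^'n \<Rightarrow> real^'d^'d"
  assumes V: "V \<in> Bp_class p" and C: "Bp_constant p V C" and p: "1 \<le> p" and Q: "open_cube Q"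
    and f: "(weight_mass V Q *v f) \<bullet> f = 1"
  shows "(\<integral>\<^sup>+y\<in>Q. ennreal (((V y *v f) \<bullet> f) powr p) \<partial>lebesgue)
     \<le> ennreal ((\<bar>C\<bar> * measure lebesgue Q powr (1 / p - 1)) powr p)"
proof -
  note Q' = open_cube_measure[OF Q]
  define m where "m = measure lebesgue Q"
  have m: "0 < m" using Q'(3) by (simp add: m_def)
  define q where "q x = (V x *v f) \<bullet> f" for x
  have q0: "0 \<le> q x" for x using V by (auto simp: Bp_class_def matrix_weight_def psd_matrix_def q_def)
  have mV: "V \<in> borel_measurable lebesgue" and Lp: "locally_Lp p V"
    using V by (auto simp: Bp_class_def matrix_weight_def)
  have [measurable]: "q \<in> borel_measurable lebesgue"
    unfolding q_def by (rule measurable_quadratic_form[OF mV])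
  have [measurable]: "Q \<in> sets lebesgue" using Q'(1) by simp
  obtain B where B: "0 < B" "\<And>A. norm ((A *v f) \<bullet> f) \<le> B * norm A"
    using linear_bounded_pos[OF linear_quadratic_form[of f]] by blast
  define I where "I = (LINT x:Q|lebesgue. q x powr p)"
  have int: "integrable lebesgue (\<lambda>x. indicator Q x *\<^sub>R (q x powr p))"
  proof (rule Bochner_Integration.integrable_bound)
    show "integrable lebesgue (\<lambda>x. B powr p * (indicator Q x *\<^sub>R (norm (V x) powr p)))"
      using locally_Lp_set_integrable[OF Lp Q'(1,2)] by (simp add: set_integrable_def)
    have "q x powr p \<le> B powr p * norm (V x) powr p" for x
    proof -
      have "q x powr p \<le> (B * norm (V x)) powr p"
        using B(2)[of "V x"] q0[of x] p by (intro powr_mono2) (auto simp: q_def)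
      then show ?thesis using B(1) by (simp add: powr_mult)
    qed
    then show "AE x in lebesgue. norm (indicator Q x *\<^sub>R (q x powr p)) \<le> norm (B powr p * (indicator Q x *\<^sub>R (norm (V x) powr p)))"
      by (intro AE_I2) (simp add: indicator_def)
  qed measurable
  have I0: "0 \<le> I" unfolding I_def set_lebesgue_integral_def by (intro integral_nonneg_AE) auto
  have "(\<integral>\<^sup>+y\<in>Q. ennreal (q y powr p) \<partial>lebesgue) = (\<integral>\<^sup>+y. ennreal (indicator Q y *\<^sub>R (q y powr p)) \<partial>lebesgue)"
    by (intro nn_integral_cong) (auto simp: indicator_def)
  also have "\<dots> = ennreal I"
    unfolding I_def set_lebesgue_integral_def by (rule nn_integral_eq_integral[OF int]) auto
  finally have eq: "(\<integral>\<^sup>+y\<in>Q. ennreal (q y powr p) \<partial>lebesgue) = ennreal I" .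
  have "((1 / m) * I) powr (1 / p) \<le> C * ((((1 / m) *\<^sub>R weight_mass V Q) *v f) \<bullet> f)"
    using C Q unfolding Bp_constant_def I_def q_def m_def by blast
  also have "\<dots> = C / m" by (simp add: scaleR_matrix_vector_assoc[symmetric] f)
  also have "\<dots> \<le> \<bar>C\<bar> / m" using m by (simp add: divide_right_mono)
  finally have "(((1 / m) * I) powr (1 / p)) powr p \<le> (\<bar>C\<bar> / m) powr p"
    using p by (intro powr_mono2) auto
  then have "(1 / m) * I \<le> (\<bar>C\<bar> / m) powr p"
    using I0 m p by (simp add: powr_powr)
  then have "I \<le> m * (\<bar>C\<bar> / m) powr p" using m by (simp add: field_simps)
  also have "\<dots> = (m powr (1 / p) * (\<bar>C\<bar> / m)) powr p"
    using m p by (subst powr_mult[of "m powr (1 / p)"]) (simp_all add: powr_powr)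
  also have "m powr (1 / p) * (\<bar>C\<bar> / m) = \<bar>C\<bar> * m powr (1 / p - 1)"
    using m by (simp add: powr_diff)
  finally show ?thesis using eq by (simp add: q_def m_def ennreal_leI)
qed

lemma nn_integral_sum_sum:
  assumes "\<And>i k. h i k \<in> borel_measurable M"
  shows "(\<integral>\<^sup>+x. (\<Sum>i\<in>A. \<Sum>k\<in>B. h i k x) \<partial>M) = (\<Sum>i\<in>A. \<Sum>k\<in>B. \<integral>\<^sup>+x. h i k x \<partial>M)"
  using assms by (simp add: nn_integral_sum)

lemma norm_matrix_power2_rows: "(norm A)\<^sup>2 = (\<Sum>k\<in>UNIV. (norm (A $ k))\<^sup>2)" for A :: "real^'n^'d"
  by (simp add: norm_vec_def L2_set_def sum_nonneg)

theorem proposition4p1: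
  fixes C\<^sub>V :: real
  assumes "3 \<le> CARD('n::finite)" and "2 \<le> CARD('d::finite)"
  shows "\<exists>C>0. \<forall>V :: real^'n \<Rightarrow> real^'d^'d.
    V \<in> Bp_class (real CARD('n) / 2) \<inter> ND_class \<longrightarrow> Bp_constant (real CARD('n) / 2) V C\<^sub>V \<longrightarrow>
    (\<forall>Q (u :: real^'n \<Rightarrow> real^'d). open_cube Q \<longrightarrow> C1_on Q u \<longrightarrow>
      (\<integral>\<^sup>+y\<in>Q. (\<integral>\<^sup>+x\<in>Q. ennreal ((norm ((matrix_inv (psd_sqrt (weight_mass V Q)) ** psd_sqrt (V y))
          *v (u x - u y)))\<^sup>2) \<partial>lebesgue) \<partial>lebesgue)
      \<le> ennreal (C * measure lebesgue Q powr (2 / real CARD('n)))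
          * (\<integral>\<^sup>+x\<in>Q. ennreal ((norm (jacobian u (at x)))\<^sup>2) \<partial>lebesgue))"
proof -
  define p where "p = real CARD('n) / 2"
  define C\<^sub>0 where "C\<^sub>0 = real CARD('d) * poincare_constant CARD('n) * \<bar>C\<^sub>V\<bar>"
  have p: "1 \<le> p" using assms(1) by (simp add: p_def)
  have pc: "0 \<le> poincare_constant k" for k by (simp add: poincare_constant_def)
  have "0 \<le> C\<^sub>0" by (simp add: C\<^sub>0_def pc)
  have main: "(\<integral>\<^sup>+y\<in>Q. (\<integral>\<^sup>+x\<in>Q. ennreal ((norm ((matrix_inv (psd_sqrt (weight_mass V Q)) ** psd_sqrt (V y))
          *v (u x - u y)))\<^sup>2) \<partial>lebesgue) \<partial>lebesgue)
      \<le> ennreal (C\<^sub>0 * measure lebesgue Q powr (2 / real CARD('n)))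
          * (\<integral>\<^sup>+x\<in>Q. ennreal ((norm (jacobian u (at x)))\<^sup>2) \<partial>lebesgue)"
    if V: "V \<in> Bp_class p" and ND: "V \<in> ND_class" and CV: "Bp_constant p V C\<^sub>V"
      and Q: "open_cube Q" and u: "C1_on Q u"
    for V :: "real^'n \<Rightarrow> real^'d^'d" and Q and u :: "real^'n \<Rightarrow> real^'d"
  proof -
    note Q' = open_cube_measure[OF Q]
    define m where "m = measure lebesgue Q"
    have m: "0 < m" "emeasure lborel Q = ennreal m" using Q'(3,4) by (auto simp: m_def)
    obtain a r where r: "0 < r" and Qbox: "Q = box a (a + r *\<^sub>R One)"
      using Q by (auto simp: open_cube_def open_cube_eq_box)
    have [measurable]: "Q \<in> sets borel" using Q'(1) by simp
    have Lp: "locally_Lp p V" and psd: "\<And>y. psd_matrix (V y)" and mV: "V \<in> borel_measurable lebesgue"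
      using V by (auto simp: Bp_class_def matrix_weight_def)
    have "pd_matrix (weight_mass V Q)"
      using ND locally_Lp_set_integrable_weight[OF Lp Q'(1,2) p] m by (auto simp: ND_class_def)
    then obtain f :: "'d \<Rightarrow> real^'d" where f: "\<And>i. (weight_mass V Q *v f i) \<bullet> f i = 1"
      and fle: "\<And>M \<xi>. psd_matrix M \<Longrightarrow> (norm ((matrix_inv (psd_sqrt (weight_mass V Q)) ** psd_sqrt M) *v \<xi>))\<^sup>2
          \<le> (\<Sum>i\<in>UNIV. (M *v f i) \<bullet> f i) * (norm \<xi>)\<^sup>2"
      using norm_normalised_sqrt_le by blast
    define A where "A = \<bar>C\<^sub>V\<bar> * m powr (1 / p - 1)"
    \<comment> \<open>The scalar weights are only Lebesgue measurable; Borel versions allow all integrals to be taken over one product of Borel measures.\<close>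
    have "\<exists>g. g \<in> borel_measurable borel \<and> (\<forall>y. 0 \<le> g y) \<and> (AE y in lborel. (V y *v f i) \<bullet> f i = g y)" for i
    proof -
      obtain h where [measurable]: "h \<in> borel_measurable lborel"
        and h: "AE y in lborel. (V y *v f i) \<bullet> f i = h y"
        using completion_ex_borel_measurable_real[OF measurable_quadratic_form[OF mV]] by blast
      have "AE y in lborel. (V y *v f i) \<bullet> f i = max 0 (h y)"
        using h
      proof eventually_elim
        case (elim y)
        have "0 \<le> (V y *v f i) \<bullet> f i" using psd[of y] by (simp add: psd_matrix_def)
        then show ?case using elim by simp
      qed
      then show ?thesis by (intro exI[of _ "\<lambda>y. max 0 (h y)"]) auto
    qed
    then have "\<forall>i. \<exists>g. g \<in> borel_measurable borel \<and> (\<forall>y. 0 \<le> g y) \<and> (AE y in lborel. (V y *v f i) \<bullet> f i = g y)"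
      by (rule allI)
    from choice[OF this] obtain g where g_spec: "\<forall>i. g i \<in> borel_measurable borel \<and> (\<forall>y. 0 \<le> g i y)
        \<and> (AE y in lborel. (V y *v f i) \<bullet> f i = g i y)" ..
    have g[measurable]: "g i \<in> borel_measurable borel" and g0: "0 \<le> g i y"
      and gV: "AE y in lborel. (V y *v f i) \<bullet> f i = g i y" for i y
      using spec[OF g_spec, of i] by auto
    have gA: "(\<integral>\<^sup>+y\<in>Q. ennreal (g i y powr (real DIM(real^'n) / 2)) \<partial>lborel) \<le> ennreal (A powr (real DIM(real^'n) / 2))" for i
    proof -
      have "(\<integral>\<^sup>+y\<in>Q. ennreal (g i y powr p) \<partial>lborel) = (\<integral>\<^sup>+y\<in>Q. ennreal (((V y *v f i) \<bullet> f i) powr p) \<partial>lborel)"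
        using gV[of i] by (intro nn_integral_cong_AE) auto
      also have "\<dots> \<le> ennreal (A powr p)"
        using reverse_hoelder_normalised[OF V CV p Q f[of i]] by (simp add: nn_integral_completion A_def m_def)
      finally show ?thesis by (simp add: p_def)
    qed
    define J where "J x = jacobian u (at x)" for x
    have dJ: "((\<lambda>x. u x $ k) has_derivative (\<lambda>h. J x $ k \<bullet> h)) (at x)" if "x \<in> Q" for x k
    proof -
      have "(u has_derivative (\<lambda>h. J x *v h)) (at x)"
        using u that jacobian_works by (auto simp: C1_on_def J_def)
      from bounded_linear.has_derivative[OF bounded_linear_vec_nth this, of k]
      show ?thesis by (simp add: matrix_vector_mul_component)
    qed
    have cJ: "continuous_on Q (\<lambda>x. J x $ k)" for k
      using u by (intro continuous_intros) (auto simp: C1_on_def J_def)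
    have cu: "continuous_on Q (\<lambda>x. u x $ k)" for k
      using dJ by (meson has_derivative_continuous continuous_at_imp_continuous_on)
    define E where "E k = (\<integral>\<^sup>+x\<in>Q. ennreal ((norm (J x $ k))\<^sup>2) \<partial>lborel)" for k
    define H where "H i k y x = ennreal (g i y * (u x $ k - u y $ k)\<^sup>2)" for i k y x
    have scalar: "(\<integral>\<^sup>+y\<in>Q. (\<integral>\<^sup>+x\<in>Q. H i k y x \<partial>lborel) \<partial>lborel) \<le> ennreal (poincare_constant CARD('n) * A) * ennreal m * E k" for i k
      using weighted_poincare_open_cube[OF _ r Qbox dJ cJ g g0 _ gA, of i k] assms(1)
      by (simp add: H_def E_def m A_def)
    define w where "w k x = indicator Q x *\<^sub>R (u x $ k)" for k x
    have [measurable]: "w k \<in> borel_measurable borel" for k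
      unfolding w_def using cu by (intro borel_measurable_continuous_on_indicator) auto
    have Hw: "(\<integral>\<^sup>+x\<in>Q. H i k y x \<partial>lborel) * indicator Q y
       = (\<integral>\<^sup>+x. ennreal (g i y * (w k x - w k y)\<^sup>2) * indicator Q x \<partial>lborel) * indicator Q y" for i k y
      by (auto simp: H_def w_def indicator_def intro!: nn_integral_cong)
    have mH: "(\<lambda>y. (\<integral>\<^sup>+x\<in>Q. H i k y x \<partial>lborel) * indicator Q y) \<in> borel_measurable borel" for i k
      unfolding Hw by measurable
    have mHx: "(\<lambda>x. H i k y x * indicator Q x) \<in> borel_measurable borel" for i k y
      unfolding H_def by (intro borel_indicator_continuous continuous_intros cu) measurable
    have "AE y in lborel. \<forall>i. (V y *v f i) \<bullet> f i = g i y"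
      using gV by (simp add: AE_all_countable)
    then have pt: "AE y in lborel.
        (\<integral>\<^sup>+x\<in>Q. ennreal ((norm ((matrix_inv (psd_sqrt (weight_mass V Q)) ** psd_sqrt (V y)) *v (u x - u y)))\<^sup>2) \<partial>lborel) * indicator Q y
         \<le> (\<Sum>i\<in>UNIV. \<Sum>k\<in>UNIV. (\<integral>\<^sup>+x\<in>Q. H i k y x \<partial>lborel) * indicator Q y)"
    proof eventually_elim
      case (elim y)
      have "ennreal ((norm ((matrix_inv (psd_sqrt (weight_mass V Q)) ** psd_sqrt (V y)) *v (u x - u y)))\<^sup>2)
         \<le> (\<Sum>i\<in>UNIV. \<Sum>k\<in>UNIV. H i k y x)" for x
      proof -
        have "(norm ((matrix_inv (psd_sqrt (weight_mass V Q)) ** psd_sqrt (V y)) *v (u x - u y)))\<^sup>2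
          \<le> (\<Sum>i\<in>UNIV. g i y) * (norm (u x - u y))\<^sup>2"
          using fle[OF psd[of y], of "u x - u y"] elim by simp
        also have "(norm (u x - u y))\<^sup>2 = (\<Sum>k\<in>UNIV. (u x $ k - u y $ k)\<^sup>2)"
          by (simp add: norm_vec_def L2_set_def sum_nonneg)
        also have "(\<Sum>i\<in>UNIV. g i y) * \<dots> = (\<Sum>i\<in>UNIV. \<Sum>k\<in>UNIV. g i y * (u x $ k - u y $ k)\<^sup>2)"
          by (simp add: sum_product)
        finally show ?thesis
          unfolding H_def by (simp add: sum_ennreal sum_nonneg g0 ennreal_leI)
      qed
      then have "(\<integral>\<^sup>+x\<in>Q. ennreal ((norm ((matrix_inv (psd_sqrt (weight_mass V Q)) ** psd_sqrt (V y)) *v (u x - u y)))\<^sup>2) \<partial>lborel)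
         \<le> (\<integral>\<^sup>+x. (\<Sum>i\<in>UNIV. \<Sum>k\<in>UNIV. H i k y x * indicator Q x) \<partial>lborel)"
        by (intro nn_integral_mono) (auto simp: indicator_def)
      also have "\<dots> = (\<Sum>i\<in>UNIV. \<Sum>k\<in>UNIV. (\<integral>\<^sup>+x\<in>Q. H i k y x \<partial>lborel))"
        by (rule nn_integral_sum_sum) (use mHx in simp)
      finally show ?case by (auto simp: indicator_def)
    qed
    have "(\<integral>\<^sup>+y\<in>Q. (\<integral>\<^sup>+x\<in>Q. ennreal ((norm ((matrix_inv (psd_sqrt (weight_mass V Q)) ** psd_sqrt (V y))
          *v (u x - u y)))\<^sup>2) \<partial>lborel) \<partial>lborel)
        \<le> (\<integral>\<^sup>+y. (\<Sum>i\<in>UNIV. \<Sum>k\<in>UNIV. (\<integral>\<^sup>+x\<in>Q. H i k y x \<partial>lborel) * indicator Q y) \<partial>lborel)"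
      by (rule nn_integral_mono_AE[OF pt])
    also have "\<dots> = (\<Sum>i\<in>UNIV. \<Sum>k\<in>UNIV. (\<integral>\<^sup>+y\<in>Q. (\<integral>\<^sup>+x\<in>Q. H i k y x \<partial>lborel) \<partial>lborel))"
      by (rule nn_integral_sum_sum) (use mH in simp)
    also have "\<dots> \<le> (\<Sum>i\<in>(UNIV::'d set). \<Sum>k\<in>UNIV. ennreal (poincare_constant CARD('n) * A) * ennreal m * E k)"
      by (intro sum_mono scalar)
    also have "\<dots> = of_nat CARD('d) * (ennreal (poincare_constant CARD('n) * A) * ennreal m) * (\<Sum>k\<in>UNIV. E k)"
      by (simp add: sum_distrib_left[symmetric] mult.assoc)
    also have "of_nat CARD('d) * (ennreal (poincare_constant CARD('n) * A) * ennreal m)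
        = ennreal (C\<^sub>0 * m powr (2 / real CARD('n)))"
    proof -
      have "m powr (1 / p - 1) * m = m powr (2 / real CARD('n))"
        using m(1) powr_add[of m "1 / p - 1" 1] by (simp add: p_def)
      then have "real CARD('d) * (poincare_constant CARD('n) * A * m) = C\<^sub>0 * m powr (2 / real CARD('n))"
        by (simp add: A_def C\<^sub>0_def mult.assoc)
      moreover have "0 \<le> poincare_constant CARD('n) * A" by (simp add: A_def pc)
      ultimately show ?thesis using m(1)
        by (simp add: ennreal_of_nat_eq_real_of_nat ennreal_mult[symmetric])
    qed
    also have "(\<Sum>k\<in>UNIV. E k) = (\<integral>\<^sup>+x\<in>Q. ennreal ((norm (J x))\<^sup>2) \<partial>lborel)"
    proof -
      have "(\<lambda>x. ennreal ((norm (J x $ k))\<^sup>2) * indicator Q x) \<in> borel_measurable borel" for k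
        by (intro borel_indicator_continuous continuous_intros cJ) measurable
      then have "(\<Sum>k\<in>UNIV. E k) = (\<integral>\<^sup>+x. (\<Sum>k\<in>UNIV. ennreal ((norm (J x $ k))\<^sup>2) * indicator Q x) \<partial>lborel)"
        unfolding E_def by (subst nn_integral_sum) auto
      also have "\<dots> = (\<integral>\<^sup>+x\<in>Q. ennreal ((norm (J x))\<^sup>2) \<partial>lborel)"
        by (intro nn_integral_cong) (simp add: norm_matrix_power2_rows sum_distrib_right[symmetric] sum_ennreal)
      finally show ?thesis .
    qed
    finally show ?thesis by (simp add: nn_integral_completion J_def m_def)
  qed
  \<comment> \<open>The summand 1 only makes the constant positive when \<open>C\<^sub>V = 0\<close>.\<close>
  show ?thesis
  proof (intro exI[of _ "C\<^sub>0 + 1"] conjI allI impI)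
    fix V :: "real^'n \<Rightarrow> real^'d^'d" and Q and u :: "real^'n \<Rightarrow> real^'d"
    assume a: "V \<in> Bp_class (real CARD('n) / 2) \<inter> ND_class" "Bp_constant (real CARD('n) / 2) V C\<^sub>V"
      "open_cube Q" "C1_on Q u"
    have "ennreal (C\<^sub>0 * measure lebesgue Q powr (2 / real CARD('n)))
        \<le> ennreal ((C\<^sub>0 + 1) * measure lebesgue Q powr (2 / real CARD('n)))"
      by (intro ennreal_leI mult_right_mono) auto
    then show "(\<integral>\<^sup>+y\<in>Q. (\<integral>\<^sup>+x\<in>Q. ennreal ((norm ((matrix_inv (psd_sqrt (weight_mass V Q)) ** psd_sqrt (V y))
          *v (u x - u y)))\<^sup>2) \<partial>lebesgue) \<partial>lebesgue)
      \<le> ennreal ((C\<^sub>0 + 1) * measure lebesgue Q powr (2 / real CARD('n)))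
          * (\<integral>\<^sup>+x\<in>Q. ennreal ((norm (jacobian u (at x)))\<^sup>2) \<partial>lebesgue)"
      using a by (intro order_trans[OF main] mult_right_mono) (auto simp: p_def)
  qed (use \<open>0 \<le> C\<^sub>0\<close> in simp)
qed

end
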